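(* Let $\chi$ be a real, non-principal, primitive Dirichlet character modulo $q$, and suppose that $L(s,\chi)\neq 0$ for all real $s$ with $0<s<1$. For real $s>1$ put $F(s,\chi):=\log L(s,\chi)$, and for each integer $k\geq 1$ let $$A_{\chi,k}:=\{s\in(1,\infty): F^{(k)}(s,\chi)=0\},$$ where $F^{(k)}$ denotes the $k$-th derivative with respect to the real variable $s$. Then there exists a constant $c_\chi\geq 1$ such that $[c_\chi,\infty)\cap\bigl(\bigcup_{k=1}^{\infty}A_{\chi,k}\bigr)$ is dense in $[c_\chi,\infty)$.
   Context: $L(s,\chi)=\sum_{n\ge1}\chi(n)n^{-s}$ is the Dirichlet $L$-function of $\chi$. For a real character $\chi$ and real $s>1$, $L(s,\chi)>0$, so $\log L(s,\chi)$ is a real-valued smooth function of the real variable $s>1$. *)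

theory Defs
  imports "HOL-Analysis.Analysis"
begin

definition dirichlet_character :: "nat \<Rightarrow> (nat \<Rightarrow> complex) \<Rightarrow> bool" where
  "dirichlet_character q chi \<longleftrightarrow>
     q > 0 \<and>
     (\<forall>m n. chi (m * n) = chi m * chi n) \<and>
     (\<forall>n. chi (n + q) = chi n) \<and>
     (\<forall>n. chi n \<noteq> 0 \<longleftrightarrow> coprime n q)"

definition principal_character :: "nat \<Rightarrow> nat \<Rightarrow> complex" where
  "principal_character q n = (if coprime n q then 1 else 0)"

definition real_character :: "(nat \<Rightarrow> complex) \<Rightarrow> bool" where
  "real_character chi \<longleftrightarrow> (\<forall>n. chi n \<in> \<real>)"

definition induces_character :: "(nat \<Rightarrow> complex) \<Rightarrow> nat \<Rightarrow> (nat \<Rightarrow> complex) \<Rightarrow> bool" where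
  "induces_character psi q chi \<longleftrightarrow> (\<forall>n. chi n = (if coprime n q then psi n else 0))"

definition primitive_character :: "nat \<Rightarrow> (nat \<Rightarrow> complex) \<Rightarrow> bool" where
  "primitive_character q chi \<longleftrightarrow>
     dirichlet_character q chi \<and>
     \<not> (\<exists>d psi. d dvd q \<and> d < q \<and> dirichlet_character d psi \<and> induces_character psi q chi)"

text \<open>
  The series, summed in the natural order of \<open>n \<ge> 1\<close>, converges for \<open>Re s > 1\<close>, and for
  non-principal \<open>chi\<close> it converges (conditionally) for \<open>Re s > 0\<close>, where it agrees with the
  analytic continuation. No value with \<open>Re s \<le> 0\<close> is meaningful.
\<close>
definition dirichlet_L :: "(nat \<Rightarrow> complex) \<Rightarrow> complex \<Rightarrow> complex" where
  "dirichlet_L chi s = (\<Sum>n. chi (Suc n) * of_nat (Suc n) powr (- s))"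

text \<open>
  For real \<open>chi\<close> and real \<open>s > 1\<close> the value of the L-function is a positive real number, so that
  \<open>Re\<close> only changes its type. Values with \<open>s \<le> 1\<close> do not affect derivatives at \<open>s > 1\<close>.
\<close>
definition log_L :: "(nat \<Rightarrow> complex) \<Rightarrow> real \<Rightarrow> real" where
  "log_L chi s = ln (Re (dirichlet_L chi (of_real s)))"

definition log_L_deriv_zeros :: "(nat \<Rightarrow> complex) \<Rightarrow> nat \<Rightarrow> real set" where
  "log_L_deriv_zeros chi k = {s \<in> {1<..}. (deriv ^^ k) (log_L chi) s = 0}"

end

theory Submission
  imports Defs "HOL-Complex_Analysis.Complex_Analysis" "HOL-Probability.Probability"
    "HOL-Number_Theory.Number_Theory" "HOL-Real_Asymp.Real_Asymp"
begin

text \<open>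
  The \<open>k\<close>-th derivative of \<open>log L\<close> at a real point \<open>s\<close> is governed by the zeros of \<open>L\<close> nearest
  to \<open>s\<close>. If these form a single pair of non-real conjugate zeros \<open>\<rho>\<close>, \<open>cnj \<rho>\<close>, then up to an explicit
  factor it is \<open>cos (k * Arg (s - \<rho>))\<close> plus an error that decays exponentially in \<open>k\<close>. For large \<open>k\<close>
  this changes sign on any given interval, because the argument varies strictly with \<open>s\<close>. Points
  equidistant from two different pairs are isolated, so they do not affect density.

  There are no real zeros in \<open>(0, \<infinity>)\<close>: on \<open>(0, 1)\<close> by hypothesis, at 1 by Monsky's Lambert series
  argument, and beyond 1 because \<open>\<zeta> * L\<close> has non-negative coefficients. A zero \<open>\<rho>\<close> of positive real
  part is closer to \<open>s\<close> than the line \<open>Re = 0\<close> once \<open>s > \<bar>\<rho>\<bar>\<^sup>2 / (2 Re \<rho>)\<close>, so it remains to find one.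
  This needs no functional equation: if \<open>L\<close> had no zero with positive real part, a normal family argument
  for \<open>L(z + i t) powr (1 / ln (1 + \<bar>t\<bar>))\<close> would give \<open>L(1/4 + i t) = O(\<bar>t\<bar>\<^sup>\<epsilon>)\<close> for every \<open>\<epsilon> > 0\<close>, but the mean
  square of \<open>L\<close> on that line, with a Gaussian weight of width \<open>X\<^sup>3\<close>, is at least of the order of
  the sum of \<open>n powr (-1/2)\<close> over \<open>n \<le> X\<close> coprime to \<open>q\<close>.
\<close>

subsection \<open>The Dirichlet series in the right half-plane\<close>

text \<open>Mean value inequality on the segment from n to n + 1: the derivative
  \<open>-s * z powr (-s - 1)\<close> is largest in modulus at the left end. The power of n gained
  over the trivial bound is what makes the Abel-summed series converge for Re s > 0.\<close>

lemma norm_powr_diff_le: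
  fixes s :: complex
  assumes "n > 0" "Re s \<ge> 0"
  shows "norm (of_nat n powr (-s) - of_nat (Suc n) powr (-s)) \<le> norm s * real n powr (-1 - Re s)"
proof -
  define S :: "complex set" where "S = closed_segment (of_nat n) (of_nat (Suc n))"
  have S: "\<exists>x. z = of_real x \<and> x \<ge> real n" if "z \<in> S" for z
  proof -
    have "z \<in> closed_segment (complex_of_real (real n)) (complex_of_real (real (Suc n)))"
      using that by (simp add: S_def)
    then show ?thesis
      unfolding closed_segment_of_real closed_segment_eq_real_ivl by auto
  qed
  have "norm ((\<lambda>z. z powr (-s)) (of_nat n :: complex) - (\<lambda>z. z powr (-s)) (of_nat (Suc n) :: complex))
     \<le> (norm s * real n powr (-1 - Re s)) * norm (of_nat n - of_nat (Suc n) :: complex)"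
  proof (rule field_differentiable_bound[of S])
    fix z assume "z \<in> S"
    then obtain x where x: "z = of_real x" "x \<ge> real n" using S by blast
    have xpos: "x > 0" using x assms by linarith
    then have "z \<notin> \<real>\<^sub>\<le>\<^sub>0" using x by (auto simp: complex_nonpos_Reals_iff)
    then show "((\<lambda>z. z powr (-s)) has_field_derivative (-s * z powr (-s - 1))) (at z within S)"
      by (rule has_field_derivative_at_within[OF has_field_derivative_powr])
    have "norm (z powr (-s - 1)) = x powr (- Re s - 1)"
      using xpos by (simp add: x norm_powr_real_powr)
    also have "\<dots> = x powr (-1 - Re s)" by (rule arg_cong[of _ _ "(powr) x"]) simp
    also have "\<dots> \<le> real n powr (-1 - Re s)"
      using x assms by (intro powr_mono2') auto
    finally show "norm (-s * z powr (-s - 1)) \<le> norm s * real n powr (-1 - Re s)"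
      by (simp add: norm_mult mult_left_mono)
  qed (simp_all add: S_def del: of_nat_Suc)
  moreover have "norm (of_nat n - of_nat (Suc n) :: complex) = 1" by simp
  ultimately show ?thesis by simp
qed

lemma summable_Suc_powr:
  assumes "a > 0"
  shows "summable (\<lambda>n. real (Suc n) powr (-1 - a))"
proof -
  have "summable (\<lambda>n. real n powr (-1 - a))"
    using assms by (subst summable_real_powr_iff) auto
  then show ?thesis by (subst summable_Suc_iff)
qed

text \<open>This is the Riemann zeta value at 1 + a; it supplies the constants in the bounds for L
  on Re s >= a.\<close>

definition zeta_shift :: "real \<Rightarrow> real" where
  "zeta_shift a = (\<Sum>n. real (Suc n) powr (-1 - a))"

lemma zeta_shift_nonneg: "a > 0 \<Longrightarrow> zeta_shift a \<ge> 0"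
  unfolding zeta_shift_def using summable_Suc_powr[of a] by (intro suminf_nonneg) auto

section \<open>Values and period sums of a real non-principal character\<close>

locale real_nonprincipal_character =
  fixes q :: nat and chi :: "nat \<Rightarrow> complex"
  assumes character: "dirichlet_character q chi"
    and real: "real_character chi"
    and nonprincipal: "chi \<noteq> principal_character q"
begin

lemma q_pos: "q > 0"
  and chi_mult: "chi (m * n) = chi m * chi n"
  and chi_add_q: "chi (n + q) = chi n"
  and chi_nonzero_iff: "chi n \<noteq> 0 \<longleftrightarrow> coprime n q"
  using character by (auto simp: dirichlet_character_def)

lemma chi_1 [simp]: "chi (Suc 0) = 1"
proof -
  have "chi 1 \<noteq> 0" by (subst chi_nonzero_iff) auto
  moreover have "chi 1 = chi 1 * chi 1" using chi_mult[of 1 1] by simp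
  ultimately show ?thesis by simp
qed

lemma chi_add_mult_q: "chi (n + k * q) = chi n"
proof (induction k)
  case (Suc k)
  have "chi (n + Suc k * q) = chi ((n + k * q) + q)" by (simp add: algebra_simps)
  then show ?case using Suc by (simp add: chi_add_q)
qed simp

lemma chi_mod [simp]: "chi (n mod q) = chi n"
  using chi_add_mult_q[of "n mod q" "n div q"] by simp

lemma chi_cong: "[m = n] (mod q) \<Longrightarrow> chi m = chi n"
  using chi_mod[of m] chi_mod[of n] by (simp add: cong_def del: chi_mod)

lemma chi_power: "chi (n ^ k) = chi n ^ k"
  by (induction k) (auto simp: chi_mult)

lemma q_gt_1: "q > 1"
proof (rule ccontr)
  assume "\<not> q > 1"
  then have "q = 1" using q_pos by simp
  have "chi n = principal_character q n" for n
    using chi_cong[of n 1] \<open>q = 1\<close> by (auto simp: principal_character_def cong_def)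
  then show False using nonprincipal by auto
qed

lemma chi_0 [simp]: "chi 0 = 0"
  using chi_nonzero_iff[of 0] q_gt_1 by auto

text \<open>By Euler's theorem a non-zero value is a root of unity, and the only real ones are 1 and
  -1.\<close>

lemma chi_cases: "chi n = 0 \<or> chi n = 1 \<or> chi n = -1"
proof (cases "coprime n q")
  case True
  have "[n ^ totient q = 1] (mod q)" using True by (rule euler_theorem)
  then have "chi n ^ totient q = 1"
    using chi_cong[of "n ^ totient q" 1] chi_power[of n "totient q"] by simp
  then have "norm (chi n) ^ totient q = 1" by (metis norm_one norm_power)
  then have "norm (chi n) = 1"
    using q_pos power_eq_iff_eq_base[of "totient q" "norm (chi n)" 1] by simp
  moreover obtain x where "chi n = of_real x"
    using real by (auto simp: real_character_def Reals_def)
  ultimately show ?thesis by (auto simp: abs_if split: if_splits)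
qed (use chi_nonzero_iff in auto)

lemma norm_chi_le: "norm (chi n) \<le> 1"
  using chi_cases[of n] by auto

text \<open>Multiplication by a unit \<open>a\<close> with \<open>chi a \<noteq> 1\<close> permutes
  the residues, so the sum equals \<open>chi a\<close> times itself.\<close>

lemma sum_chi_period: "(\<Sum>n<q. chi n) = 0"
proof -
  obtain a where "chi a \<noteq> principal_character q a" using nonprincipal by auto
  then have a: "coprime a q" "chi a \<noteq> 1"
    using chi_nonzero_iff[of a] by (auto simp: principal_character_def split: if_splits)
  have inj: "inj_on (\<lambda>n. (a * n) mod q) {..<q}"
  proof (rule inj_onI)
    fix m n assume "m \<in> {..<q}" "n \<in> {..<q}" "(a * m) mod q = (a * n) mod q"
    then show "m = n"
      using a(1) cong_mult_lcancel_nat[of a q m n] by (auto simp: cong_def)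
  qed
  have "(\<lambda>n. (a * n) mod q) ` {..<q} = {..<q}"
    using inj q_pos by (intro endo_inj_surj) auto
  then have "(\<Sum>n<q. chi n) = (\<Sum>n<q. chi ((a * n) mod q))"
    using sum.reindex[OF inj, of chi] by simp
  also have "\<dots> = chi a * (\<Sum>n<q. chi n)"
    by (simp add: chi_mult sum_distrib_left)
  finally show ?thesis using a(2) by simp
qed

section \<open>Abel summation and the half-plane Re s > 0\<close>

definition chi_sum :: "nat \<Rightarrow> complex" where
  "chi_sum N = (\<Sum>n<N. chi (Suc n))"

lemma chi_sum_eq: "chi_sum N = (\<Sum>n<Suc N. chi n)"
  unfolding chi_sum_def by (subst sum.lessThan_Suc_shift) simp

lemma sum_chi_block: "(\<Sum>n<k * q + m. chi n) = (\<Sum>n<m. chi n)"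
proof (induction k)
  case (Suc k)
  have "(\<Sum>n<Suc k * q + m. chi n) = (\<Sum>n<q. chi n) + (\<Sum>n<k * q + m. chi (n + q))"
    using sum.atLeastLessThan_concat[of 0 q "Suc k * q + m" chi]
      sum.shift_bounds_nat_ivl[of chi 0 q "k * q + m"]
    by (simp add: lessThan_atLeast0 add_ac)
  then show ?case using Suc by (simp add: sum_chi_period chi_add_q)
qed simp

text \<open>Complete periods cancel, which leaves fewer than q terms of modulus at most 1.\<close>

lemma norm_chi_sum_le: "norm (chi_sum N) \<le> q"
proof -
  define m where "m = Suc N mod q"
  have "chi_sum N = (\<Sum>n<m. chi n)"
    using sum_chi_block[of "Suc N div q" m] by (simp add: chi_sum_eq m_def del: sum.lessThan_Suc)
  also have "norm \<dots> \<le> (\<Sum>n<m. 1)"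
    by (intro sum_norm_le norm_chi_le)
  also have "\<dots> \<le> q" using q_pos by (simp add: m_def less_imp_le)
  finally show ?thesis .
qed

definition partial_L :: "nat \<Rightarrow> complex \<Rightarrow> complex" where
  "partial_L N s = (\<Sum>n<N. chi (Suc n) * of_nat (Suc n) powr (-s))"

text \<open>Terms of the series after summation by parts. Bounded character sums make this version
  absolutely convergent for Re s > 0, where the defining series need not be.\<close>

definition abel_term :: "nat \<Rightarrow> complex \<Rightarrow> complex" where
  "abel_term n s = chi_sum (Suc n) * (of_nat (Suc n) powr (-s) - of_nat (Suc (Suc n)) powr (-s))"

lemma partial_L_abel:
  "partial_L N s = (\<Sum>n<N. abel_term n s) + chi_sum N * of_nat (Suc N) powr (-s)"
  by (induction N) (auto simp: partial_L_def abel_term_def chi_sum_def algebra_simps)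

lemma norm_abel_term_le:
  assumes "0 < a" "a \<le> Re s"
  shows "norm (abel_term n s) \<le> q * norm s * real (Suc n) powr (-1 - a)"
proof -
  have "norm (abel_term n s) \<le> q * (norm s * real (Suc n) powr (-1 - Re s))"
    unfolding abel_term_def norm_mult
    by (intro mult_mono norm_chi_sum_le norm_powr_diff_le) (use assms in auto)
  also have "\<dots> \<le> q * (norm s * real (Suc n) powr (-1 - a))"
    by (intro mult_left_mono powr_mono) (use assms in auto)
  finally show ?thesis by (simp add: mult.assoc)
qed

text \<open>The bound is uniform in N, so it passes to L itself and also serves as a dominating
  function when the mean square of L is obtained from those of its partial sums.\<close>

lemma norm_partial_L_le:
  assumes "0 < a" "a \<le> Re s"
  shows "norm (partial_L N s) \<le> q * (norm s * zeta_shift a + 1)"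
proof -
  have "norm (\<Sum>n<N. abel_term n s) \<le> (\<Sum>n<N. q * norm s * real (Suc n) powr (-1 - a))"
    by (intro sum_norm_le norm_abel_term_le assms)
  also have "\<dots> = q * norm s * (\<Sum>n<N. real (Suc n) powr (-1 - a))"
    by (simp add: sum_distrib_left)
  also have "\<dots> \<le> q * norm s * zeta_shift a"
    unfolding zeta_shift_def
    by (intro mult_left_mono sum_le_suminf summable_Suc_powr assms) auto
  finally have 1: "norm (\<Sum>n<N. abel_term n s) \<le> q * norm s * zeta_shift a" .
  have "norm (of_nat (Suc N) powr (-s)) = real (Suc N) powr (- Re s)"
    using norm_powr_real_powr[of "of_nat (Suc N)" "-s"] by (simp del: of_nat_Suc)
  also have "\<dots> \<le> real (Suc N) powr 0"
    by (intro powr_mono) (use assms in auto)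
  finally have "norm (of_nat (Suc N) powr (-s)) \<le> 1" by simp
  then have "norm (chi_sum N * of_nat (Suc N) powr (-s)) \<le> real q * 1"
    unfolding norm_mult by (intro mult_mono norm_chi_sum_le) auto
  then show ?thesis
    unfolding partial_L_abel
    using 1 norm_triangle_ineq[of "\<Sum>n<N. abel_term n s" "chi_sum N * of_nat (Suc N) powr (-s)"]
    by (simp add: algebra_simps del: of_nat_Suc)
qed

lemma abel_sum_uniform_limit:
  assumes "0 < a"
  shows "uniform_limit {s. a \<le> Re s \<and> norm s \<le> R} (\<lambda>N s. \<Sum>n<N. abel_term n s)
           (\<lambda>s. \<Sum>n. abel_term n s) sequentially"
proof (rule Weierstrass_m_test)
  fix n s assume "s \<in> {s. a \<le> Re s \<and> norm s \<le> R}"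
  then have "norm (abel_term n s) \<le> q * norm s * real (Suc n) powr (-1 - a)" "norm s \<le> R"
    using norm_abel_term_le assms by auto
  moreover have "q * norm s * real (Suc n) powr (-1 - a) \<le> q * R * real (Suc n) powr (-1 - a)"
    using \<open>norm s \<le> R\<close> by (intro mult_right_mono mult_left_mono) auto
  ultimately show "norm (abel_term n s) \<le> q * R * real (Suc n) powr (-1 - a)" by linarith
qed (intro summable_mult summable_Suc_powr assms)

text \<open>The boundary term of the summation by parts decays like N^(-Re s), so the original
  series and the Abel-summed one have the same limit.\<close>

lemma partial_L_tendsto:
  assumes "Re s > 0"
  shows "(\<lambda>N. partial_L N s) \<longlonglongrightarrow> dirichlet_L chi s"
    and "dirichlet_L chi s = (\<Sum>n. abel_term n s)"
proof -
  have lim1: "(\<lambda>N. \<Sum>n<N. abel_term n s) \<longlonglongrightarrow> (\<Sum>n. abel_term n s)"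
    using tendsto_uniform_limitI[OF abel_sum_uniform_limit[OF assms, of "norm s"]] by simp
  have lim2: "(\<lambda>N. chi_sum N * of_nat (Suc N) powr (-s)) \<longlonglongrightarrow> 0"
  proof (rule Lim_null_comparison)
    have "norm (chi_sum N * of_nat (Suc N) powr (-s)) \<le> q * real (Suc N) powr (- Re s)" for N
      using norm_chi_sum_le[of N] norm_powr_real_powr[of "of_nat (Suc N)" "-s"]
      by (auto simp: norm_mult mult_right_mono simp del: of_nat_Suc)
    then show "\<forall>\<^sub>F N in sequentially. norm (chi_sum N * of_nat (Suc N) powr (-s)) \<le> q * real (Suc N) powr (- Re s)"
      by simp
    have "(\<lambda>N. real (Suc N) powr (- Re s)) \<longlonglongrightarrow> 0"
      using assms by (intro LIMSEQ_Suc tendsto_neg_powr filterlim_real_sequentially) auto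
    then show "(\<lambda>N. q * real (Suc N) powr (- Re s)) \<longlonglongrightarrow> 0"
      by (rule tendsto_mult_right_zero)
  qed
  have *: "(\<lambda>N. partial_L N s) \<longlonglongrightarrow> (\<Sum>n. abel_term n s)"
    unfolding partial_L_abel using tendsto_add[OF lim1 lim2] by simp
  then have "(\<lambda>n. chi (Suc n) * of_nat (Suc n) powr (-s)) sums (\<Sum>n. abel_term n s)"
    by (simp add: sums_def partial_L_def)
  then show "dirichlet_L chi s = (\<Sum>n. abel_term n s)"
    unfolding dirichlet_L_def by (rule sums_unique[symmetric])
  with * show "(\<lambda>N. partial_L N s) \<longlonglongrightarrow> dirichlet_L chi s" by simp
qed

lemma dirichlet_L_sums:
  assumes "Re s > 0"
  shows "(\<lambda>n. chi (Suc n) * of_nat (Suc n) powr (-s)) sums dirichlet_L chi s"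
  using partial_L_tendsto(1)[OF assms] by (simp add: sums_def partial_L_def)

lemma norm_dirichlet_L_le:
  assumes "0 < a" "a \<le> Re s"
  shows "norm (dirichlet_L chi s) \<le> q * (norm s * zeta_shift a + 1)"
proof (rule tendsto_upperbound)
  show "(\<lambda>N. norm (partial_L N s)) \<longlonglongrightarrow> norm (dirichlet_L chi s)"
    using assms by (intro tendsto_norm partial_L_tendsto(1)) auto
qed (use norm_partial_L_le[OF assms] in auto)

lemma holomorphic_dirichlet_L: "dirichlet_L chi holomorphic_on {s. Re s > 0}"
proof (rule holomorphic_uniform_sequence)
  show "open {s. Re s > 0}" by (simp add: open_halfspace_Re_gt)
  show "(\<lambda>s. \<Sum>n<N. abel_term n s) holomorphic_on {s. Re s > 0}" for N
    unfolding abel_term_def by (intro holomorphic_intros)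
      (auto simp: complex_nonpos_Reals_iff simp del: of_nat_Suc)
  fix s assume "s \<in> {s. Re s > 0}"
  then have s: "Re s > 0" by simp
  \<comment> \<open>Half the distance to the line Re = 0: the closed disc then stays in Re >= d,
    where the M-test applies uniformly.\<close>
  define d where "d = Re s / 2"
  have sub: "cball s d \<subseteq> {z. d \<le> Re z \<and> norm z \<le> norm s + d}"
  proof
    fix z assume "z \<in> cball s d"
    then have "norm (z - s) \<le> d" by (simp add: dist_norm norm_minus_commute)
    moreover have "\<bar>Re (z - s)\<bar> \<le> norm (z - s)" by (rule abs_Re_le_cmod)
    moreover have "norm z \<le> norm s + norm (z - s)" using norm_triangle_ineq[of s "z - s"] by simp
    moreover have "Re s = 2 * d" by (simp add: d_def)
    ultimately show "z \<in> {z. d \<le> Re z \<and> norm z \<le> norm s + d}" by auto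
  qed
  have "d > 0" using s by (simp add: d_def)
  have "uniform_limit (cball s d) (\<lambda>N s. \<Sum>n<N. abel_term n s) (\<lambda>s. \<Sum>n. abel_term n s) sequentially"
    using uniform_limit_on_subset[OF abel_sum_uniform_limit[OF \<open>d > 0\<close>] sub] .
  also have "?this \<longleftrightarrow> uniform_limit (cball s d) (\<lambda>N s. \<Sum>n<N. abel_term n s) (dirichlet_L chi) sequentially"
    using sub \<open>d > 0\<close> by (intro uniform_limit_cong') (auto simp: partial_L_tendsto(2))
  finally show "\<exists>d>0. cball s d \<subseteq> {s. 0 < Re s} \<and>
     uniform_limit (cball s d) (\<lambda>N s. \<Sum>n<N. abel_term n s) (dirichlet_L chi) sequentially"
    using sub \<open>d > 0\<close> by (intro exI[of _ d]) auto
qed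

lemma chi_of_real: "of_real (Re (chi n)) = chi n"
  using real by (auto simp: real_character_def)

lemma dirichlet_L_of_real:
  assumes "s > 0"
  shows "(\<lambda>n. Re (chi (Suc n)) * real (Suc n) powr (-s)) sums Re (dirichlet_L chi (of_real s))"
    and "Im (dirichlet_L chi (of_real s)) = 0"
proof -
  have eq: "chi (Suc n) * of_nat (Suc n) powr (- of_real s) = of_real (Re (chi (Suc n)) * real (Suc n) powr (-s))" for n
    using powr_of_real[of "real (Suc n)" "-s"] by (simp add: chi_of_real del: of_nat_Suc)
  have sums: "(\<lambda>n. of_real (Re (chi (Suc n)) * real (Suc n) powr (-s))) sums dirichlet_L chi (of_real s)"
    using dirichlet_L_sums[of "of_real s"] assms unfolding eq by simp
  show "(\<lambda>n. Re (chi (Suc n)) * real (Suc n) powr (-s)) sums Re (dirichlet_L chi (of_real s))"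
    using sums_Re[OF sums] by (simp del: of_nat_Suc)
  show "Im (dirichlet_L chi (of_real s)) = 0"
    using sums_unique[OF sums_Im[OF sums]] by (simp del: of_nat_Suc)
qed

end

subsection \<open>Non-vanishing on the real half-line from 1\<close>

text \<open>Every divisor of \<open>p ^ k * m\<close> is uniquely \<open>p ^ i * d\<close> with
  \<open>i \<le> k\<close> and \<open>d dvd m\<close>; comparing multiplicities of p gives
  uniqueness.\<close>

lemma sum_divisors_prime_power_mult:
  fixes f :: "nat \<Rightarrow> real"
  assumes mult: "\<And>m n. f (m * n) = f m * f n" and p: "prime p" "\<not> p dvd m" and "m > 0" and f1: "f 1 = 1"
  shows "(\<Sum>d | d dvd p ^ k * m. f d) = (\<Sum>i\<le>k. f p ^ i) * (\<Sum>d | d dvd m. f d)"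
proof -
  have pow: "f (p ^ i) = f p ^ i" for i
    by (induction i) (use f1 mult in auto)
  have inj: "inj_on (\<lambda>(i, d). p ^ i * d) ({..k} \<times> {d. d dvd m})"
  proof (rule inj_onI, clarify)
    fix i d j e
    assume "d dvd m" "e dvd m" and eq: "p ^ i * d = p ^ j * e"
    have "\<not> p dvd d" "\<not> p dvd e"
      using p \<open>d dvd m\<close> \<open>e dvd m\<close> dvd_trans by blast+
    then have "multiplicity p (p ^ i * d) = i" "multiplicity p (p ^ j * e) = j"
      using p by (auto intro!: multiplicity_eqI simp: power_Suc2 simp del: power_Suc)
    then have "i = j" using eq by simp
    then show "i = j \<and> d = e" using eq p by (auto simp: prime_gt_0_nat)
  qed
  have "{d. d dvd p ^ k * m} = (\<lambda>(i, d). p ^ i * d) ` ({..k} \<times> {d. d dvd m})"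
  proof (intro equalityI subsetI)
    fix d assume "d \<in> {d. d dvd p ^ k * m}"
    then obtain b c where "d = b * c" "b dvd p ^ k" "c dvd m"
      using division_decomp by blast
    then show "d \<in> (\<lambda>(i, d). p ^ i * d) ` ({..k} \<times> {d. d dvd m})"
      using divides_primepow_nat[OF p(1)] by auto
  next
    fix d assume "d \<in> (\<lambda>(i, d). p ^ i * d) ` ({..k} \<times> {d. d dvd m})"
    then show "d \<in> {d. d dvd p ^ k * m}"
      by (auto intro!: mult_dvd_mono le_imp_power_dvd)
  qed
  then have "(\<Sum>d | d dvd p ^ k * m. f d) = (\<Sum>x\<in>{..k} \<times> {d. d dvd m}. f (case x of (i, d) \<Rightarrow> p ^ i * d))"
    using sum.reindex[OF inj, of f] by (simp add: o_def)
  also have "\<dots> = (\<Sum>(i, d)\<in>{..k} \<times> {d. d dvd m}. f p ^ i * f d)"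
    by (intro sum.cong) (auto simp: mult pow)
  also have "\<dots> = (\<Sum>i\<le>k. f p ^ i) * (\<Sum>d | d dvd m. f d)"
    by (simp add: sum.cartesian_product[symmetric] sum_product)
  finally show ?thesis .
qed

text \<open>Induction that splits off one full prime power at a time and checks that its factor is
  non-negative.\<close>

lemma sum_divisors_nonneg:
  fixes f :: "nat \<Rightarrow> real"
  assumes mult: "\<And>m n. f (m * n) = f m * f n" and f1: "f 1 = 1"
    and vals: "\<And>n. f n = 0 \<or> f n = 1 \<or> f n = -1" and "n > 0"
  shows "(\<Sum>d | d dvd n. f d) \<ge> 0"
  using \<open>n > 0\<close>
proof (induction n rule: less_induct)
  case (less n)
  show ?case
  proof (cases "n = 1")
    case False
    then obtain p where p: "prime p" "p dvd n" using prime_factor_nat by blast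
    have pu: "\<not> is_unit p" using p(1) by auto
    obtain m where m: "n = p ^ multiplicity p n * m" "\<not> p dvd m"
      using multiplicity_decompose'[of n p] less.prems pu by auto
    have "m > 0" using m(1) less.prems by (cases "m = 0") auto
    have "multiplicity p n > 0" using p less.prems by (simp add: prime_multiplicity_gt_zero_iff)
    then have "p ^ multiplicity p n > 1" using p(1) prime_gt_1_nat[of p] by (intro one_less_power) auto
    then have "m * 1 < m * p ^ multiplicity p n" using \<open>m > 0\<close> by (intro mult_strict_left_mono) auto
    also have "m * p ^ multiplicity p n = n" using m(1) by (simp only: mult.commute)
    finally have "m < n" by simp
    \<comment> \<open>The only delicate value is \<open>f p = -1\<close>, where the alternating sum
      is 1 or 0.\<close>
    have "(\<Sum>i\<le>k. f p ^ i) \<ge> 0" for k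
    proof -
      have *: "(\<Sum>i\<le>k. (-1) ^ i) = (if even k then 1 else 0 :: real)"
        by (induction k) auto
      show ?thesis using vals[of p] by (auto simp: * sum_nonneg)
    qed
    moreover have "(\<Sum>d | d dvd m. f d) \<ge> 0"
      using less.IH[OF \<open>m < n\<close> \<open>m > 0\<close>] .
    moreover have "(\<Sum>d | d dvd n. f d) = (\<Sum>i\<le>multiplicity p n. f p ^ i) * (\<Sum>d | d dvd m. f d)"
      using sum_divisors_prime_power_mult[OF mult p(1) m(2) \<open>m > 0\<close> f1, of "multiplicity p n"] m(1) by simp
    ultimately show ?thesis by simp
  qed (use f1 in simp)
qed

text \<open>Both sides are the sum of \<^term>\<open>f d * G (d * m)\<close> over pairs \<^term>\<open>(d, m)\<close>, grouped by
  \<^term>\<open>n = d * m\<close> on the left.\<close>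
lemma sum_divisors_le_double_series:
  fixes f G g :: "nat \<Rightarrow> real"
  assumes G: "\<And>n. n > 0 \<Longrightarrow> G n \<ge> 0" and f: "\<And>n. \<bar>f n\<bar> \<le> 1"
    and inner: "\<And>d. d > 0 \<Longrightarrow> (\<lambda>m. G (d * Suc m)) sums g d"
    and summable: "summable (\<lambda>n. g (Suc n))"
    and nonneg: "\<And>n. n > 0 \<Longrightarrow> (\<Sum>d | d dvd n. f d) \<ge> 0"
    and F: "finite F" "0 \<notin> F"
  shows "(\<Sum>n\<in>F. (\<Sum>d | d dvd n. f d) * G n) \<le> (\<Sum>n. f (Suc n) * g (Suc n))"
proof -
  define A :: "nat set" where "A = {0<..}"
  have bij: "bij_betw Suc UNIV A"
    unfolding A_def by (intro bij_betwI[of _ _ _ "\<lambda>n. n - 1"]) auto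
  define K where "K = (\<lambda>(d, m). f d * G (d * m))"
  have gs: "((\<lambda>m. G (d * m)) has_sum g d) A" if "d \<in> A" for d
  proof -
    have "((\<lambda>m. G (d * Suc m)) has_sum g d) UNIV"
      using inner[of d] that G by (intro sums_nonneg_imp_has_sum) (auto simp: A_def)
    then show ?thesis using has_sum_reindex_bij_betw[OF bij, of "\<lambda>m. G (d * m)"] by simp
  qed
  have g_nonneg: "g d \<ge> 0" if "d \<in> A" for d
    using gs[OF that] by (rule has_sum_nonneg) (use G that in \<open>auto simp: A_def\<close>)
  have "(\<lambda>n. g (Suc n)) summable_on UNIV"
    using summable g_nonneg by (intro norm_summable_imp_summable_on) (auto simp: A_def)
  then have gsum: "g summable_on A"
    using has_sum_reindex_bij_betw[OF bij, of g] by (auto simp: summable_on_def)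
  have Gsum: "(\<lambda>(d, m). G (d * m)) summable_on (A \<times> A)"
    by (rule summable_on_SigmaI[where g = g]) (use gs gsum G in \<open>auto simp: A_def\<close>)
  \<comment> \<open>Since f is bounded by 1, the non-negative double series of
    \<open>G (d * m)\<close> dominates. This absolute summability is what permits the
    regrouping.\<close>
  have "(\<lambda>x. norm (K x)) summable_on (A \<times> A)"
  proof (rule summable_on_comparison_test[OF Gsum])
    fix x assume "x \<in> A \<times> A"
    then have "G (fst x * snd x) \<ge> 0" using G by (auto simp: A_def)
    moreover have "norm (K x) = \<bar>f (fst x)\<bar> * G (fst x * snd x)"
      using calculation by (simp add: K_def case_prod_beta abs_mult)
    ultimately show "norm (K x) \<le> (case x of (d, m) \<Rightarrow> G (d * m))"
      using mult_right_mono[OF f[of "fst x"], of "G (fst x * snd x)"] by (simp add: case_prod_beta)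
  qed auto
  then have "K summable_on (A \<times> A)" by (rule abs_summable_summable)
  then obtain S where S: "(K has_sum S) (A \<times> A)" by (auto simp: summable_on_def)
  have "((\<lambda>d. f d * g d) has_sum S) A"
    by (rule has_sum_SigmaD[OF S]) (auto simp: K_def intro!: has_sum_cmult_right gs)
  then have "((\<lambda>n. f (Suc n) * g (Suc n)) has_sum S) UNIV"
    using has_sum_reindex_bij_betw[OF bij, of "\<lambda>d. f d * g d"] by simp
  then have S_eq: "(\<Sum>n. f (Suc n) * g (Suc n)) = S"
    by (intro sums_unique[symmetric] has_sum_imp_sums)
  have "((\<lambda>(n, d). f d * G n) has_sum S) (Sigma A (\<lambda>n. {d. d dvd n}))"
  proof (subst has_sum_reindex_bij_witness[where T = "A \<times> A" and h = K
        and j = "\<lambda>(n, d). (d, n div d)" and i = "\<lambda>(d, m). (d * m, d)" and s' = S])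
  qed (use S in \<open>auto simp: K_def A_def dvd_pos_nat div_greater_zero_iff dvd_imp_le\<close>)
  then have "((\<lambda>n. \<Sum>d | d dvd n. f d * G n) has_sum S) A"
    by (rule has_sum_SigmaD) (auto simp: A_def intro!: has_sum_finite)
  then have "((\<lambda>n. (\<Sum>d | d dvd n. f d) * G n) has_sum S) A"
    by (simp add: sum_distrib_right)
  then have "(\<Sum>n\<in>F. (\<Sum>d | d dvd n. f d) * G n) \<le> S"
  proof (rule finite_sum_le_has_sum)
    show "F \<subseteq> A" using F by (auto simp: A_def intro: Suc_leI) (metis gr0I)
    show "(\<Sum>d | d dvd n. f d) * G n \<ge> 0" if "n \<in> A - F" for n
      using that nonneg[of n] G[of n] by (auto simp: A_def)
  qed (use F in auto)
  then show ?thesis using S_eq by simp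
qed

section \<open>Monotonicity of the Lambert weights\<close>

lemma geometric_sum_ge:
  fixes y :: real
  assumes "y \<ge> 0"
  shows "(\<Sum>i\<le>n. (y\<^sup>2) ^ i) \<ge> (real n + 1) * y ^ n"
proof -
  \<comment> \<open>Pair the terms i and n - i; each pair is at least \<open>2 * y ^ n\<close> by
    the inequality between arithmetic and geometric means.\<close>
  have "2 * ((real n + 1) * y ^ n) = (\<Sum>i\<le>n. 2 * y ^ n)" by simp
  also have "\<dots> \<le> (\<Sum>i\<le>n. (y\<^sup>2) ^ i + (y\<^sup>2) ^ (n - i))"
  proof (rule sum_mono)
    fix i assume i: "i \<in> {..n}"
    have "0 \<le> (y ^ i - y ^ (n - i))\<^sup>2" by simp
    also have "\<dots> = (y\<^sup>2) ^ i + (y\<^sup>2) ^ (n - i) - 2 * (y ^ i * y ^ (n - i))"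
      by (simp add: power2_diff power_mult[symmetric] mult.commute)
    also have "y ^ i * y ^ (n - i) = y ^ n" using i by (simp add: power_add[symmetric])
    finally show "2 * y ^ n \<le> (y\<^sup>2) ^ i + (y\<^sup>2) ^ (n - i)" by simp
  qed
  also have "\<dots> = (\<Sum>i\<le>n. (y\<^sup>2) ^ i) + (\<Sum>i\<le>n. (y\<^sup>2) ^ (n - i))" by (rule sum.distrib)
  also have "(\<Sum>i\<le>n. (y\<^sup>2) ^ (n - i)) = (\<Sum>i\<le>n. (y\<^sup>2) ^ i)"
    by (rule sum.nat_diff_reindex[of "\<lambda>i. (y\<^sup>2) ^ i" "Suc n", unfolded lessThan_Suc_atMost, simplified])
  finally show ?thesis by simp
qed

text \<open>The Lambert weight \<open>x ^ n / (1 - x ^ n)\<close> subtracted from its leading part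
  as x tends to 1. Weighted with a character, the leading parts add up to L(1) / (1 - x).\<close>

definition lambert_defect :: "real \<Rightarrow> nat \<Rightarrow> real" where
  "lambert_defect x n = 1 / (real n * (1 - x)) - x ^ n / (1 - x ^ n)"

text \<open>With A and B the geometric sums up to n - 1 and n, the claim times 1 - x reads x^n / (A
  B) <= 1 / (n (n + 1)). This follows from \<open>geometric_sum_ge\<close> with y the square root of
  x, because y^(2n - 1) >= x^n.\<close>

lemma lambert_defect_decreasing:
  assumes x: "0 < x" "x < 1" and n: "n > 0"
  shows "lambert_defect x (Suc n) \<le> lambert_defect x n"
proof -
  define y where "y = sqrt x"
  have y: "x = y\<^sup>2" "0 < y" "y < 1" using x by (auto simp: y_def real_sqrt_lt_1_iff)
  obtain k where k: "n = Suc k" using n by (cases n) auto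
  define A where "A = (\<Sum>i\<le>k. x ^ i)"
  define B where "B = (\<Sum>i\<le>n. x ^ i)"
  have A: "1 - x ^ n = (1 - x) * A" and B: "1 - x ^ Suc n = (1 - x) * B"
    unfolding A_def B_def k using x sum_gp0[of x k] sum_gp0[of x "Suc k"]
    by (simp_all del: power_Suc sum.atMost_Suc)
  have "A \<ge> real n * y ^ k" "B \<ge> (real n + 1) * y ^ n"
    using geometric_sum_ge[of y k] geometric_sum_ge[of y n] y by (simp_all add: A_def B_def k add_ac)
  moreover have "A > 0" "B > 0"
    unfolding A_def B_def using x by (auto intro!: sum_pos)
  ultimately have "A * B \<ge> (real n * y ^ k) * ((real n + 1) * y ^ n)"
    using y by (intro mult_mono) auto
  also have "(real n * y ^ k) * ((real n + 1) * y ^ n) = (real n * (real n + 1)) * y ^ (n + k)"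
    by (simp add: power_add)
  also have "\<dots> \<ge> (real n * (real n + 1)) * y ^ (n + n)"
    using y by (intro mult_left_mono power_decreasing) (auto simp: k)
  also have "y ^ (n + n) = x ^ n" by (simp add: y(1) power_mult[symmetric] mult_2)
  finally have AB: "(real n * (real n + 1)) * x ^ n \<le> A * B" .
  have diff: "B - x * A = 1"
    unfolding A_def B_def k by (subst sum.atMost_Suc_shift) (simp add: sum_distrib_left)
  have x1: "1 - x \<noteq> 0" using x by simp
  have quot: "1 / r - t / a \<ge> 0" if "r > 0" "a > 0" "r * t \<le> a" for r t a :: real
    using that by (simp add: field_simps)
  have cancel: "c * (1 / (r * c) - t / (c * a)) = 1 / r - t / a" if "c \<noteq> 0" for c r t a :: real
    by (simp add: right_diff_distrib that)
  have "(1 - x) * lambert_defect x n = 1 / n - x ^ n / A"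
    and "(1 - x) * lambert_defect x (Suc n) = 1 / real (Suc n) - x ^ Suc n / B"
    unfolding lambert_defect_def A B by (rule cancel[OF x1])+
  then have "(1 - x) * (lambert_defect x n - lambert_defect x (Suc n))
      = (1 / n - 1 / (real n + 1)) - (x ^ n / A - x ^ Suc n / B)"
    by (simp add: right_diff_distrib add.commute)
  also have "1 / n - 1 / (real n + 1) = 1 / (real n * (real n + 1))"
    using n by (simp add: field_simps)
  also have "x ^ n / A - x ^ Suc n / B = x ^ n * (B - x * A) / (A * B)"
    using \<open>A > 0\<close> \<open>B > 0\<close> by (simp add: field_simps)
  also have "\<dots> = x ^ n / (A * B)" by (simp add: diff)
  also have "1 / (real n * (real n + 1)) - x ^ n / (A * B) \<ge> 0"
    by (rule quot) (use AB \<open>A > 0\<close> \<open>B > 0\<close> n in auto)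
  finally have "(1 - x) * (lambert_defect x n - lambert_defect x (Suc n)) \<ge> 0" .
  then show ?thesis using x by (simp add: zero_le_mult_iff)
qed

lemma lambert_defect_tendsto_0:
  assumes "0 < x" "x < 1"
  shows "lambert_defect x \<longlonglongrightarrow> 0"
proof -
  have "(\<lambda>n. x ^ n) \<longlonglongrightarrow> 0" using assms by (intro LIMSEQ_power_zero) auto
  then have "(\<lambda>n. x ^ n / (1 - x ^ n)) \<longlonglongrightarrow> 0 / (1 - 0)" by (intro tendsto_divide tendsto_diff tendsto_const) auto
  moreover have "(\<lambda>n. (1 / (1 - x)) * (1 / real n)) \<longlonglongrightarrow> (1 / (1 - x)) * 0"
    by (intro tendsto_intros lim_1_over_n)
  ultimately have "(\<lambda>n. (1 / (1 - x)) * (1 / real n) - x ^ n / (1 - x ^ n)) \<longlonglongrightarrow> (1 / (1 - x)) * 0 - 0 / (1 - 0)"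
    by (intro tendsto_diff)
  then show ?thesis by (simp add: lambert_defect_def[abs_def] mult.commute)
qed

text \<open>Abel's inequality: after summation by parts the differences of b telescope.\<close>

lemma abs_sum_mult_decreasing_le:
  fixes a b :: "nat \<Rightarrow> real"
  assumes dec: "\<And>n. b (Suc n) \<le> b n" and pos: "\<And>n. b n \<ge> 0"
    and bound: "\<And>N. \<bar>\<Sum>n<N. a n\<bar> \<le> C"
  shows "\<bar>\<Sum>n<N. a n * b n\<bar> \<le> C * b 0"
proof -
  define T where "T N = (\<Sum>n<N. a n)" for N
  have abel: "(\<Sum>n<N. a n * b n) = (\<Sum>n<N. T (Suc n) * (b n - b (Suc n))) + T N * b N" for N
    by (induction N) (auto simp: T_def algebra_simps)
  have tel: "(\<Sum>n<N. b n - b (Suc n)) = b 0 - b N" by (induction N) auto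
  have T: "\<bar>T n\<bar> \<le> C" for n using bound by (simp add: T_def)
  have "\<bar>\<Sum>n<N. T (Suc n) * (b n - b (Suc n))\<bar> \<le> (\<Sum>n<N. C * (b n - b (Suc n)))"
  proof (rule order.trans[OF sum_abs sum_mono])
    fix n show "\<bar>T (Suc n) * (b n - b (Suc n))\<bar> \<le> C * (b n - b (Suc n))"
      using mult_right_mono[OF T[of "Suc n"], of "b n - b (Suc n)"] dec[of n] by (simp add: abs_mult)
  qed
  also have "\<dots> = C * (b 0 - b N)" by (simp add: sum_distrib_left[symmetric] tel)
  finally have "\<bar>\<Sum>n<N. T (Suc n) * (b n - b (Suc n))\<bar> \<le> C * (b 0 - b N)" .
  moreover have "\<bar>T N * b N\<bar> \<le> C * b N"
    using mult_right_mono[OF T[of N] pos[of N]] pos[of N] by (simp add: abs_mult)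
  ultimately show ?thesis unfolding abel by (simp add: algebra_simps)
qed

section \<open>Positivity beyond 1 and non-vanishing at 1\<close>

context real_nonprincipal_character
begin

lemma Re_chi_mult: "Re (chi (m * n)) = Re (chi m) * Re (chi n)"
  using chi_cases[of m] chi_cases[of n] by (auto simp: chi_mult)

lemma Re_chi_cases: "Re (chi n) = 0 \<or> Re (chi n) = 1 \<or> Re (chi n) = -1"
  using chi_cases[of n] by auto

lemma divisor_chi_sum_nonneg: "n > 0 \<Longrightarrow> (\<Sum>d | d dvd n. Re (chi d)) \<ge> 0"
  by (rule sum_divisors_nonneg) (auto simp: Re_chi_mult Re_chi_cases)

text \<open>A divisor of a power of q other than 1 shares a factor with q, so only d = 1
  contributes. These are the coefficients equal to 1 that make the Lambert series large near
  1.\<close>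

lemma divisor_chi_sum_q_power: "(\<Sum>d | d dvd q ^ k. Re (chi d)) = 1"
proof -
  have "Re (chi d) = 0" if "d dvd q ^ k" "d \<noteq> 1" for d
  proof -
    have "\<not> coprime d q"
    proof
      assume "coprime d q"
      then have "coprime d (q ^ k)" by simp
      then show False using that coprime_common_divisor_nat[of d "q ^ k" d] by simp
    qed
    then show ?thesis using chi_nonzero_iff[of d] by auto
  qed
  then have "(\<Sum>d | d dvd q ^ k. Re (chi d)) = (\<Sum>d\<in>{1}. Re (chi d))"
    using q_pos by (intro sum.mono_neutral_right) (auto intro!: finite_divisors_nat)
  then show ?thesis by simp
qed

text \<open>Here Z is the zeta value at s. The product Z * L is the series of the divisor sums of
  \<open>chi\<close> against n^(-s); these are non-negative, and n = 1 alone contributes 1.\<close>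

lemma Re_dirichlet_L_pos:
  assumes s: "s > 1"
  shows "Re (dirichlet_L chi (of_real s)) > 0"
proof -
  define Z where "Z = (\<Sum>n. real (Suc n) powr (-s))"
  have sm: "summable (\<lambda>n. real (Suc n) powr (-s))"
    using summable_Suc_powr[of "s - 1"] s by simp
  have "(\<Sum>n\<in>{1}. (\<Sum>d | d dvd n. Re (chi d)) * real n powr (-s))
      \<le> (\<Sum>n. Re (chi (Suc n)) * (real (Suc n) powr (-s) * Z))"
  proof (rule sum_divisors_le_double_series)
    show "\<bar>Re (chi n)\<bar> \<le> 1" for n using Re_chi_cases[of n] by auto
    show "(\<lambda>m. real (d * Suc m) powr (-s)) sums (real d powr (-s) * Z)" for d
      using sums_mult[OF summable_sums[OF sm], of "real d powr (-s)"]
      by (simp add: Z_def powr_mult del: of_nat_Suc mult_Suc_right)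
    show "summable (\<lambda>n. real (Suc n) powr (-s) * Z)" by (rule summable_mult2[OF sm])
  qed (auto simp: divisor_chi_sum_nonneg)
  also have "\<dots> = (\<Sum>n. (Re (chi (Suc n)) * real (Suc n) powr (-s)) * Z)"
    by (simp add: mult.assoc)
  also have "\<dots> = Re (dirichlet_L chi (of_real s)) * Z"
    using sums_mult2[OF dirichlet_L_of_real(1)[of s], of Z] s
    by (intro sums_unique[symmetric]) auto
  finally have "1 \<le> Re (dirichlet_L chi (of_real s)) * Z" by simp
  moreover have "Z \<ge> 0" unfolding Z_def using sm by (intro suminf_nonneg) auto
  ultimately show ?thesis
    by (metis less_eq_real_def mult_nonpos_nonneg not_le not_one_le_zero order_trans)
qed

text \<open>Monsky's argument: if the series vanished at 1, the Lambert series of \<^term>\<open>chi\<close>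
  would stay bounded near 1, whereas its coefficients are non-negative and infinitely
  many of them are equal to 1.\<close>
lemma dirichlet_L_1_nonzero: "Re (dirichlet_L chi 1) \<noteq> 0"
proof
  assume "Re (dirichlet_L chi 1) = 0"
  then have L1: "(\<lambda>n. Re (chi (Suc n)) * (1 / real (Suc n))) sums 0"
    using dirichlet_L_of_real(1)[of 1] by (simp add: powr_minus_divide del: of_nat_Suc)
  define f where "f x = (\<Sum>n. Re (chi (Suc n)) * (x ^ Suc n / (1 - x ^ Suc n)))" for x :: real
  have geo: "(\<lambda>m. x ^ (d * Suc m)) sums (x ^ d / (1 - x ^ d))" if "0 < x" "x < 1" "d > 0" for x :: real and d
  proof -
    have "norm (x ^ d) < 1" using that by (simp add: power_less_one_iff abs_of_pos)
    from sums_mult[OF geometric_sums[OF this], of "x ^ d"] show ?thesis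
      by (simp add: power_mult power_add)
  qed
  have fsum: "summable (\<lambda>n. x ^ Suc n / (1 - x ^ Suc n))" if x: "0 < x" "x < 1" for x :: real
  proof (rule summable_comparison_test')
    show "summable (\<lambda>n. x ^ Suc n / (1 - x))"
      using x by (intro summable_divide summable_Suc_iff[THEN iffD2] summable_geometric) auto
    fix n
    have "x ^ Suc n \<le> x" "x ^ Suc n > 0"
      using power_decreasing[of 1 "Suc n" x] x by auto
    then show "norm (x ^ Suc n / (1 - x ^ Suc n)) \<le> x ^ Suc n / (1 - x)"
      using x by (auto simp: abs_of_nonneg intro!: divide_left_mono simp del: power_Suc)
  qed
  have upper: "f x \<le> q" if x: "0 < x" "x < 1" for x :: real
  proof -
    have "(\<lambda>n. Re (chi (Suc n)) * (x ^ Suc n / (1 - x ^ Suc n))) sums f x"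
      unfolding f_def
    proof (rule summable_sums, rule summable_comparison_test'[OF fsum[OF x]])
      fix n
      have "x ^ Suc n / (1 - x ^ Suc n) \<ge> 0"
        using x by (intro divide_nonneg_nonneg) (auto simp: power_le_one simp del: power_Suc)
      moreover have "\<bar>Re (chi (Suc n))\<bar> \<le> 1" using Re_chi_cases[of "Suc n"] by auto
      ultimately show "norm (Re (chi (Suc n)) * (x ^ Suc n / (1 - x ^ Suc n))) \<le> x ^ Suc n / (1 - x ^ Suc n)"
        unfolding real_norm_def abs_mult
        by (subst abs_of_nonneg[of "x ^ Suc n / (1 - x ^ Suc n)"]) (simp_all only: mult_left_le_one_le abs_ge_zero)
    qed
    \<comment> \<open>Because L(1) = 0, inserting the leading parts costs nothing and turns -f into
      a series with decreasing weights. Abel's inequality then bounds it by q times the first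
      weight, which is 1.\<close>
    from sums_diff[OF sums_mult2[OF L1, of "1 / (1 - x)"] this]
    have "(\<lambda>n. Re (chi (Suc n)) * lambert_defect x (Suc n)) sums (- f x)"
      by (simp add: lambert_defect_def right_diff_distrib mult.assoc del: of_nat_Suc power_Suc)
    then have lim: "(\<lambda>N. \<Sum>n<N. Re (chi (Suc n)) * lambert_defect x (Suc n)) \<longlonglongrightarrow> - f x"
      by (simp add: sums_def)
    have dec: "lambert_defect x (Suc (Suc n)) \<le> lambert_defect x (Suc n)" for n
      by (rule lambert_defect_decreasing[OF x]) simp
    have "lambert_defect x (Suc n) \<ge> 0" for n
    proof (rule decseq_ge[of "\<lambda>n. lambert_defect x (Suc n)"])
      show "decseq (\<lambda>n. lambert_defect x (Suc n))" using dec by (rule decseq_SucI)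
      show "(\<lambda>n. lambert_defect x (Suc n)) \<longlonglongrightarrow> 0"
        using lambert_defect_tendsto_0[OF x] by (rule LIMSEQ_Suc)
    qed
    moreover have "\<bar>\<Sum>n<N. Re (chi (Suc n))\<bar> \<le> q" for N
      using norm_chi_sum_le[of N] abs_Re_le_cmod[of "chi_sum N"] by (simp add: chi_sum_def)
    ultimately have "\<bar>\<Sum>n<N. Re (chi (Suc n)) * lambert_defect x (Suc n)\<bar> \<le> q * lambert_defect x (Suc 0)" for N
      using dec by (intro abs_sum_mult_decreasing_le) auto
    moreover have "lambert_defect x (Suc 0) = 1"
      using x by (simp add: lambert_defect_def diff_divide_distrib[symmetric])
    ultimately have "\<bar>- f x\<bar> \<le> q"
      using tendsto_rabs[OF lim] by (intro tendsto_upperbound[OF tendsto_rabs[OF lim]]) auto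
    then show ?thesis by linarith
  qed
  \<comment> \<open>Keep only n = q^k for k = 0, ..., q. These q + 1 terms tend to 1 each as x tends
    to 1, which exceeds the upper bound q.\<close>
  have lower: "(\<Sum>k\<le>q. x ^ (q ^ k)) \<le> f x" if x: "0 < x" "x < 1" for x :: real
  proof -
    have inj: "inj_on (\<lambda>k. q ^ k) {..q}" using q_gt_1 by (auto intro!: inj_onI)
    have "(\<Sum>k\<le>q. x ^ (q ^ k)) = (\<Sum>k\<le>q. (\<Sum>d | d dvd q ^ k. Re (chi d)) * x ^ (q ^ k))"
      by (simp add: divisor_chi_sum_q_power)
    also have "\<dots> = (\<Sum>n\<in>(\<lambda>k. q ^ k) ` {..q}. (\<Sum>d | d dvd n. Re (chi d)) * x ^ n)"
      by (simp add: sum.reindex[OF inj])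
    also have "\<dots> \<le> f x"
      unfolding f_def
    proof (rule sum_divisors_le_double_series)
      show "\<bar>Re (chi n)\<bar> \<le> 1" for n using Re_chi_cases[of n] by auto
    qed (use x geo fsum q_pos in \<open>auto simp: divisor_chi_sum_nonneg simp del: power_Suc mult_Suc_right\<close>)
    finally show ?thesis .
  qed
  have "((\<lambda>x::real. \<Sum>k\<le>q. x ^ (q ^ k)) \<longlongrightarrow> (\<Sum>k\<le>q. 1 ^ (q ^ k))) (at_left 1)"
    by (intro tendsto_intros)
  moreover have "\<forall>\<^sub>F x::real in at_left 1. (\<Sum>k\<le>q. x ^ (q ^ k)) \<le> q"
    using eventually_at_left_real[of 0 "1::real"]
  proof (rule eventually_mono)
    show "0 < (1::real)" by simp
    fix x :: real assume "x \<in> {0<..<1}"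
    then show "(\<Sum>k\<le>q. x ^ (q ^ k)) \<le> q" using upper[of x] lower[of x] by simp
  qed
  ultimately have "(\<Sum>k\<le>q. (1::real) ^ (q ^ k)) \<le> q"
    by (intro tendsto_upperbound) auto
  then show False by simp
qed

end

subsection \<open>Growth and mean values on vertical lines\<close>

text \<open>Let P be the full sum and Q its part over B. Expanding |P - Q|^2 >= 0 gives |P|^2 >= Re
  ((2 P - Q) cnj Q), in which every product has an index in B. Pairs with both indices outside B
  thus never enter, so the loss can be bounded uniformly as A grows. The Gaussian factor is the
  characteristic function of the normal law.\<close>

lemma mean_square_trig_polynomial_ge:
  fixes c :: "nat \<Rightarrow> complex" and w :: "nat \<Rightarrow> real"
  assumes "finite A" "B \<subseteq> A"
  shows "(LINT u|std_normal_distribution. (norm (\<Sum>m\<in>A. c m * iexp (w m * u)))\<^sup>2) \<ge>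
    (\<Sum>n\<in>B. (norm (c n))\<^sup>2) -
    2 * (\<Sum>n\<in>B. \<Sum>m\<in>A - {n}. norm (c m) * norm (c n) * exp (- ((w m - w n)\<^sup>2) / 2))"
proof -
  interpret real_distribution std_normal_distribution by (rule real_dist_normal_dist)
  let ?M = std_normal_distribution
  have "finite B" using assms finite_subset by blast
  define P Q where "P u = (\<Sum>m\<in>A. c m * iexp (w m * u))" and "Q u = (\<Sum>m\<in>B. c m * iexp (w m * u))" for u
  \<comment> \<open>Coefficients of 2 P - Q: 2 - 1 on B and 2 elsewhere. The diagonal therefore has
    weight 1, the other terms at most 2.\<close>
  define d where "d m = (if m \<in> B then 1 else 2 :: complex)" for m
  define V where "V u = (\<Sum>m\<in>A. d m * c m * iexp (w m * u))" for u
  define \<kappa> where "\<kappa> m n = exp (- ((w m - w n)\<^sup>2) / 2)" for m n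
  have int1: "integrable ?M (\<lambda>u. iexp (t * u))" for t
    by (intro integrable_iexp) auto
  have V_eq: "V u = 2 * P u - Q u" for u
  proof -
    have "V u = (\<Sum>m\<in>A. 2 * (c m * iexp (w m * u)) - (if m \<in> B then c m * iexp (w m * u) else 0))"
      unfolding V_def d_def by (intro sum.cong) auto
    also have "\<dots> = 2 * P u - (\<Sum>m\<in>A. if m \<in> B then c m * iexp (w m * u) else 0)"
      by (simp add: sum_subtractf sum_distrib_left P_def)
    also have "(\<Sum>m\<in>A. if m \<in> B then c m * iexp (w m * u) else 0) = Q u"
      unfolding Q_def using assms by (simp add: sum.inter_restrict[symmetric] Int_absorb1)
    finally show ?thesis .
  qed
  have pw: "Re (V u * cnj (Q u)) \<le> (norm (P u))\<^sup>2" for u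
  proof -
    have "0 \<le> (norm (P u - Q u))\<^sup>2" by simp
    also have "\<dots> = (norm (P u))\<^sup>2 - Re (V u * cnj (Q u))"
      unfolding V_eq cmod_power2 by (simp add: power2_eq_square algebra_simps)
    finally show ?thesis by simp
  qed
  have VQ: "V u * cnj (Q u) = (\<Sum>m\<in>A. \<Sum>n\<in>B. d m * c m * cnj (c n) * iexp ((w m - w n) * u))" for u
    unfolding V_def Q_def cnj_sum sum_product
    by (intro sum.cong refl) (simp add: exp_cnj ring_distribs exp_diff exp_minus field_simps)
  have intVQ: "integrable ?M (\<lambda>u. V u * cnj (Q u))"
    unfolding VQ by (intro Bochner_Integration.integrable_sum integrable_mult_right int1)
  have "(LINT u|?M. V u * cnj (Q u)) = (\<Sum>m\<in>A. \<Sum>n\<in>B. d m * c m * cnj (c n) * char ?M (w m - w n))"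
  proof -
    have "(LINT u|?M. V u * cnj (Q u)) = (\<Sum>m\<in>A. LINT u|?M. (\<Sum>n\<in>B. d m * c m * cnj (c n) * iexp ((w m - w n) * u)))"
      unfolding VQ by (intro Bochner_Integration.integral_sum Bochner_Integration.integrable_sum integrable_mult_right int1)
    also have "\<dots> = (\<Sum>m\<in>A. \<Sum>n\<in>B. LINT u|?M. d m * c m * cnj (c n) * iexp ((w m - w n) * u))"
      by (intro sum.cong refl Bochner_Integration.integral_sum integrable_mult_right int1)
    also have "\<dots> = (\<Sum>m\<in>A. \<Sum>n\<in>B. d m * c m * cnj (c n) * char ?M (w m - w n))"
      unfolding char_def by (intro sum.cong refl integral_mult_right_zero)
    finally show ?thesis .
  qed
  also have "\<dots> = (\<Sum>n\<in>B. \<Sum>m\<in>A. d m * c m * cnj (c n) * of_real (\<kappa> m n))"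
    by (subst sum.swap) (simp add: char_std_normal_distribution \<kappa>_def)
  finally have intVQ_eq: "(LINT u|?M. V u * cnj (Q u)) = \<dots>" .
  have inner: "Re (\<Sum>m\<in>A. d m * c m * cnj (c n) * of_real (\<kappa> m n)) \<ge>
      (norm (c n))\<^sup>2 - 2 * (\<Sum>m\<in>A - {n}. norm (c m) * norm (c n) * \<kappa> m n)" if "n \<in> B" for n
  proof -
    have "(\<Sum>m\<in>A. d m * c m * cnj (c n) * of_real (\<kappa> m n)) = d n * c n * cnj (c n) * of_real (\<kappa> n n)
        + (\<Sum>m\<in>A - {n}. d m * c m * cnj (c n) * of_real (\<kappa> m n))"
      using assms that by (intro sum.remove) auto
    also have "d n * c n * cnj (c n) * of_real (\<kappa> n n) = of_real ((norm (c n))\<^sup>2)"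
      using that by (simp only: d_def \<kappa>_def complex_norm_square) simp
    finally have "Re (\<Sum>m\<in>A. d m * c m * cnj (c n) * of_real (\<kappa> m n)) =
       (norm (c n))\<^sup>2 + Re (\<Sum>m\<in>A - {n}. d m * c m * cnj (c n) * of_real (\<kappa> m n))" by simp
    moreover have "norm (\<Sum>m\<in>A - {n}. d m * c m * cnj (c n) * of_real (\<kappa> m n))
        \<le> (\<Sum>m\<in>A - {n}. 2 * (norm (c m) * norm (c n) * \<kappa> m n))"
    proof (rule sum_norm_le)
      fix m
      have "norm (d m) * (norm (c m) * norm (c n) * \<kappa> m n) \<le> 2 * (norm (c m) * norm (c n) * \<kappa> m n)"
        by (intro mult_right_mono) (auto simp: d_def \<kappa>_def)
      then show "norm (d m * c m * cnj (c n) * of_real (\<kappa> m n)) \<le> 2 * (norm (c m) * norm (c n) * \<kappa> m n)"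
        by (simp add: norm_mult \<kappa>_def mult.assoc)
    qed
    then have "\<bar>Re (\<Sum>m\<in>A - {n}. d m * c m * cnj (c n) * of_real (\<kappa> m n))\<bar>
        \<le> 2 * (\<Sum>m\<in>A - {n}. norm (c m) * norm (c n) * \<kappa> m n)"
      unfolding sum_distrib_left by (rule order.trans[OF abs_Re_le_cmod])
    ultimately show ?thesis by linarith
  qed
  have "(\<Sum>n\<in>B. (norm (c n))\<^sup>2) - 2 * (\<Sum>n\<in>B. \<Sum>m\<in>A - {n}. norm (c m) * norm (c n) * \<kappa> m n)
     = (\<Sum>n\<in>B. (norm (c n))\<^sup>2 - 2 * (\<Sum>m\<in>A - {n}. norm (c m) * norm (c n) * \<kappa> m n))"
    by (simp add: sum_subtractf sum_distrib_left)
  also have "\<dots> \<le> (\<Sum>n\<in>B. Re (\<Sum>m\<in>A. d m * c m * cnj (c n) * of_real (\<kappa> m n)))"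
    by (intro sum_mono inner)
  also have "\<dots> = Re (LINT u|?M. V u * cnj (Q u))" unfolding intVQ_eq by simp
  also have "\<dots> = (LINT u|?M. Re (V u * cnj (Q u)))"
    by (rule integral_Re[OF intVQ, symmetric])
  also have "\<dots> \<le> (LINT u|?M. (norm (P u))\<^sup>2)"
  proof (rule integral_mono)
    show "integrable ?M (\<lambda>u. Re (V u * cnj (Q u)))" using intVQ by (rule integrable_Re)
    show "integrable ?M (\<lambda>u. (norm (P u))\<^sup>2)"
    proof (rule integrable_const_bound[where B = "(\<Sum>m\<in>A. norm (c m))\<^sup>2"])
      have "norm (P u) \<le> (\<Sum>m\<in>A. norm (c m))" for u
        unfolding P_def by (intro sum_norm_le) (simp add: norm_mult)
      then show "AE u in ?M. norm ((norm (P u))\<^sup>2) \<le> (\<Sum>m\<in>A. norm (c m))\<^sup>2"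
        by (intro AE_I2) (simp add: power_mono)
      show "(\<lambda>u. (norm (P u))\<^sup>2) \<in> borel_measurable ?M"
        unfolding P_def by measurable
    qed
  qed (use pw in auto)
  finally show ?thesis unfolding P_def \<kappa>_def .
qed

lemma ln_nat_diff_ge:
  fixes a b :: nat
  assumes "0 < a" "a < b"
  shows "ln (real b) - ln (real a) \<ge> 1 / (real a + 1)"
proof -
  have "1 - 1 / (real (Suc a) / real a) \<le> ln (real (Suc a) / real a)"
    using ln_le_minus_one[of "real a / real (Suc a)"] assms
    by (simp add: ln_div)
  also have "\<dots> = ln (real (Suc a)) - ln (real a)" using assms by (simp add: ln_div)
  also have "\<dots> \<le> ln (real b) - ln (real a)" using assms by simp
  also have "1 - 1 / (real (Suc a) / real a) = 1 / (real a + 1)" using assms by (simp add: field_simps)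
  finally show ?thesis by simp
qed

text \<open>Logarithms of distinct integers, one of them at most X, differ by at least 1 / (X + 1),
  and the scale X^3 magnifies this enough. The bound is chosen so that summing over all m and over X
  values of n gives O(1).\<close>

lemma gaussian_offdiagonal_le:
  fixes m n X :: nat
  assumes X: "X \<ge> 4" and n: "0 < n" "n \<le> X" and m: "0 < m" "m \<noteq> n"
  shows "exp (- ((real X ^ 3 * ln (real m) - real X ^ 3 * ln (real n))\<^sup>2) / 2) \<le> 1 / (real X * (real m)\<^sup>2)"
proof -
  define y where "y = \<bar>ln (real m) - ln (real n)\<bar>"
  define x where "x = real X"
  have x: "x \<ge> 4" using X by (simp add: x_def)
  have "y \<ge> 1 / (x + 1)"
  proof (cases "m < n")
    case True
    have "1 / (x + 1) \<le> 1 / (real m + 1)" using True n by (intro divide_left_mono) (auto simp: x_def)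
    then show ?thesis using ln_nat_diff_ge[of m n] True m unfolding y_def by linarith
  next
    case False
    have "1 / (x + 1) \<le> 1 / (real n + 1)" using n by (intro divide_left_mono) (auto simp: x_def)
    then show ?thesis using ln_nat_diff_ge[of n m] False m n unfolding y_def by linarith
  qed
  moreover have "1 / (x + 1) \<ge> 1 / (2 * x)" using x by (intro divide_left_mono) auto
  ultimately have y: "y \<ge> 1 / (2 * x)" by linarith
  have xy: "x * y \<ge> 1 / 2" using mult_left_mono[OF y, of x] x by simp
  have y0: "y \<ge> 0" by (simp add: y_def)
  have "ln (real n) \<le> ln x" using n by (simp add: x_def)
  moreover have "ln (real m) \<le> ln (real n) + y" by (simp add: y_def)
  moreover have "ln x \<le> x" using ln_le_minus_one[of x] x by simp
  ultimately have "ln x + 2 * ln (real m) \<le> 3 * x + 2 * y" by linarith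
  \<comment> \<open>From x y >= 1/2 the right side is at least x^4 (x y) / 4. One half of this pays
    for 3 x, the other for 2 y, which is unbounded as m grows.\<close>
  also have "\<dots> \<le> (x ^ 3 * y)\<^sup>2 / 2"
  proof -
    have x3: "x ^ 3 \<ge> 64" using power_mono[of 4 x 3] x by simp
    have x4: "x ^ 4 \<ge> 256" using power_mono[of 4 x 4] x by simp
    have "(x ^ 3 * y)\<^sup>2 / 2 = (x * y) * (x ^ 4 * (x * y)) / 2" by (simp add: power2_eq_square eval_nat_numeral algebra_simps)
    also have "\<dots> \<ge> (1 / 2) * (x ^ 4 * (x * y)) / 2"
      using xy x y0 by (intro divide_right_mono mult_right_mono) auto
    finally have *: "(x ^ 3 * y)\<^sup>2 / 2 \<ge> x ^ 4 * (x * y) / 4" by simp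
    have "x ^ 4 * (x * y) \<ge> x ^ 4 * (1 / 2)" using xy x by (intro mult_left_mono) auto
    moreover have "x ^ 4 = x ^ 3 * x" by (simp add: eval_nat_numeral)
    moreover have "x ^ 3 * x \<ge> 64 * x" using x3 x by (intro mult_right_mono) auto
    ultimately have 1: "x ^ 4 * (x * y) / 8 \<ge> 3 * x" using x by linarith
    have "x ^ 4 * (x * y) \<ge> 256 * (4 * y)" using x4 x y0 by (intro mult_mono) auto
    then have 2: "x ^ 4 * (x * y) / 8 \<ge> 2 * y" using y0 by linarith
    from 1 2 * show ?thesis by linarith
  qed
  also have "(x ^ 3 * y)\<^sup>2 = (x ^ 3 * ln (real m) - x ^ 3 * ln (real n))\<^sup>2"
    unfolding y_def by (simp add: power_mult_distrib right_diff_distrib[symmetric])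
  finally have "- ((x ^ 3 * ln (real m) - x ^ 3 * ln (real n))\<^sup>2) / 2 \<le> - (ln x + 2 * ln (real m))" by simp
  then have "exp (- ((x ^ 3 * ln (real m) - x ^ 3 * ln (real n))\<^sup>2) / 2) \<le> exp (- (ln x + 2 * ln (real m)))" by simp
  also have "\<dots> = 1 / (x * (real m)\<^sup>2)"
    unfolding exp_minus using x m by (simp add: exp_add exp_double inverse_eq_divide)
  finally show ?thesis by (simp add: x_def)
qed

section \<open>Growth on vertical lines in the absence of zeros\<close>

context real_nonprincipal_character
begin

text \<open>For n >= 2 one has n^(-\<sigma>) <= 2^(2 - \<sigma>) n^(-2), so the tail vanishes as
  \<sigma> grows, uniformly in the imaginary part.\<close>

lemma dirichlet_L_near_1:
  obtains \<sigma> where "\<sigma> > 0" "\<And>s. Re s \<ge> \<sigma> \<Longrightarrow> norm (dirichlet_L chi s - 1) \<le> 1 / 2"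
proof -
  define Z where "Z = zeta_shift 1"
  have Z: "Z \<ge> 0" by (simp add: Z_def zeta_shift_nonneg)
  have sm: "summable (\<lambda>n. real (Suc n) powr (-2))" using summable_Suc_powr[of 1] by simp
  have "((\<lambda>\<sigma>::real. 2 powr (2 - \<sigma>) * Z) \<longlongrightarrow> 0) at_top" by real_asymp
  then have "\<forall>\<^sub>F \<sigma> in at_top. 2 powr (2 - \<sigma>) * Z < 1 / 2" by (rule order_tendstoD) simp
  then have "\<forall>\<^sub>F \<sigma> in at_top. 2 powr (2 - \<sigma>) * Z < 1 / 2 \<and> \<sigma> > (2::real)"
    using eventually_gt_at_top[of 2] by (rule eventually_conj)
  then obtain \<sigma> where \<sigma>: "2 powr (2 - \<sigma>) * Z < 1 / 2" "\<sigma> > 2"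
    using eventually_happens'[OF trivial_limit_at_top_linorder] by blast
  have "norm (dirichlet_L chi s - 1) \<le> 1 / 2" if s: "Re s \<ge> \<sigma>" for s
  proof -
    define a where "a n = chi (Suc n) * of_nat (Suc n) powr (-s)" for n
    have "a sums dirichlet_L chi s" unfolding a_def using s \<sigma> by (intro dirichlet_L_sums) auto
    then have "(\<lambda>n. a (Suc n)) sums (dirichlet_L chi s - a 0)" by (simp add: sums_Suc_iff)
    moreover have "a 0 = 1" by (simp add: a_def)
    ultimately have sums: "(\<lambda>n. a (Suc n)) sums (dirichlet_L chi s - 1)" by simp
    have bd: "norm (a (Suc n)) \<le> 2 powr (2 - \<sigma>) * real (Suc (Suc n)) powr (-2)" for n
    proof -
      define x where "x = real (Suc (Suc n))"
      have x: "x \<ge> 2" by (simp add: x_def)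
      have "norm (a (Suc n)) \<le> 1 * norm (of_nat (Suc (Suc n)) powr (-s))"
        unfolding a_def norm_mult by (intro mult_right_mono norm_chi_le) auto
      also have "\<dots> = x powr (- Re s)"
        using norm_powr_real_powr[of "of_nat (Suc (Suc n))" "-s"] by (simp add: x_def del: of_nat_Suc)
      also have "\<dots> \<le> x powr (- \<sigma>)" using s x by (intro powr_mono) auto
      also have "\<dots> = x powr (2 - \<sigma>) * x powr (-2)" by (simp add: powr_add[symmetric])
      also have "\<dots> \<le> 2 powr (2 - \<sigma>) * x powr (-2)"
        using x \<sigma> by (intro mult_right_mono powr_mono2') auto
      finally show ?thesis by (simp add: x_def)
    qed
    have sm2: "summable (\<lambda>n. 2 powr (2 - \<sigma>) * real (Suc (Suc n)) powr (-2))"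
      using sm by (intro summable_mult) (subst summable_Suc_iff[of "\<lambda>n. real (Suc n) powr (-2)"])
    have sma: "summable (\<lambda>n. norm (a (Suc n)))"
      by (rule summable_comparison_test'[OF sm2]) (use bd in auto)
    have "norm (dirichlet_L chi s - 1) = norm (\<Sum>n. a (Suc n))" using sums by (simp add: sums_iff)
    also have "\<dots> \<le> (\<Sum>n. norm (a (Suc n)))" by (rule summable_norm[OF sma])
    also have "\<dots> \<le> (\<Sum>n. 2 powr (2 - \<sigma>) * real (Suc (Suc n)) powr (-2))"
      by (rule suminf_le[OF bd sma sm2])
    also have "\<dots> = 2 powr (2 - \<sigma>) * (\<Sum>n. real (Suc (Suc n)) powr (-2))"
      using sm by (intro suminf_mult) (subst summable_Suc_iff[of "\<lambda>n. real (Suc n) powr (-2)"])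
    also have "(\<Sum>n. real (Suc (Suc n)) powr (-2)) \<le> Z"
      using suminf_split_head[OF sm] by (simp add: Z_def zeta_shift_def)
    finally show ?thesis using \<sigma> by (simp add: mult_left_mono)
  qed
  then show ?thesis using that[of \<sigma>] \<sigma> by simp
qed

text \<open>Normalising by the exponent \<^term>\<open>1 / ln (1 + \<bar>t\<bar>)\<close> turns the vertical translates into a
  normal family; a limit function has modulus 1 far to the right, hence everywhere.\<close>
lemma dirichlet_L_subpolynomial:
  assumes nz: "\<And>s. Re s > 0 \<Longrightarrow> dirichlet_L chi s \<noteq> 0" and a: "a > 0" and \<epsilon>: "\<epsilon> > 0"
  shows "\<exists>C. \<forall>t. norm (dirichlet_L chi (Complex a t)) \<le> C * (1 + \<bar>t\<bar>) powr \<epsilon>"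
proof (rule ccontr)
  assume "\<not> ?thesis"
  then have large: "\<exists>t. norm (dirichlet_L chi (Complex a t)) > C * (1 + \<bar>t\<bar>) powr \<epsilon>" for C
    by (auto simp: not_le)
  define H where "H = {s. Re s > 0}"
  have H: "open H" "convex H" "connected H"
    by (auto simp: H_def open_halfspace_Re_gt convex_halfspace_Re_gt convex_connected)
  have lin: "norm (dirichlet_L chi (z + \<i> * of_real t)) \<le> (q * ((R + 1) * zeta_shift b + 1)) * (1 + \<bar>t\<bar>)"
    if "0 < b" "b \<le> Re z" "norm z \<le> R" for z t b R
  proof -
    have R: "R \<ge> 0" using that norm_ge_zero order_trans by blast
    have "norm (z + \<i> * of_real t) \<le> norm z + norm (\<i> * of_real t)" by (rule norm_triangle_ineq)
    also have "\<dots> \<le> R + \<bar>t\<bar>" using that by (simp add: norm_mult)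
    also have "\<dots> \<le> (R + 1) * (1 + \<bar>t\<bar>)" using R by (simp add: algebra_simps)
    finally have 1: "norm (z + \<i> * of_real t) \<le> (R + 1) * (1 + \<bar>t\<bar>)" .
    have "norm (dirichlet_L chi (z + \<i> * of_real t)) \<le> q * (norm (z + \<i> * of_real t) * zeta_shift b + 1)"
      by (rule norm_dirichlet_L_le) (use that in auto)
    also have "\<dots> \<le> q * ((R + 1) * (1 + \<bar>t\<bar>) * zeta_shift b + (1 + \<bar>t\<bar>))"
      using 1 zeta_shift_nonneg[OF that(1)] by (intro mult_left_mono add_mono mult_right_mono) auto
    finally show ?thesis by (simp add: algebra_simps)
  qed
  define B where "B = q * ((a + 1) * zeta_shift a + 1)"
  have B: "B > 0" using q_pos a zeta_shift_nonneg[OF a] by (simp add: B_def add_nonneg_pos)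
  \<comment> \<open>Compared with the linear bound \<open>B * (1 + \<bar>t\<bar>)\<close>, the
    summand n forces the heights to infinity and \<open>B * exp 1\<close> forces
    \<open>l n \<ge> 1\<close>; the final 1 keeps the constant at least 1.\<close>
  have "\<forall>n. \<exists>t. norm (dirichlet_L chi (Complex a t)) > (real n + B * exp 1 + 1) * (1 + \<bar>t\<bar>) powr \<epsilon>"
    by (intro allI large)
  then obtain t where t: "\<And>n. norm (dirichlet_L chi (Complex a (t n))) > (real n + B * exp 1 + 1) * (1 + \<bar>t n\<bar>) powr \<epsilon>"
    unfolding choice_iff by blast
  have L_eq: "dirichlet_L chi (Complex a u) = dirichlet_L chi (of_real a + \<i> * of_real u)" for u
    by (simp add: complex_eq_iff Complex_eq)
  have tn: "real n + B * exp 1 + 1 < B * (1 + \<bar>t n\<bar>)" for n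
  proof -
    have "(real n + B * exp 1 + 1) * 1 \<le> (real n + B * exp 1 + 1) * (1 + \<bar>t n\<bar>) powr \<epsilon>"
      using B \<epsilon> by (intro mult_left_mono ge_one_powr_ge_zero) auto
    also have "\<dots> < norm (dirichlet_L chi (Complex a (t n)))" by (rule t)
    also have "\<dots> \<le> B * (1 + \<bar>t n\<bar>)"
      unfolding L_eq B_def by (rule lin) (use a in auto)
    finally show ?thesis by simp
  qed
  define l where "l n = ln (1 + \<bar>t n\<bar>)" for n
  have l1: "l n \<ge> 1" for n
  proof -
    have "B * exp 1 \<le> B * (1 + \<bar>t n\<bar>)" using tn[of n] by simp
    then have "exp 1 \<le> 1 + \<bar>t n\<bar>" using B by simp
    then show ?thesis unfolding l_def by (subst ln_ge_iff) auto
  qed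
  have "filterlim l at_top sequentially"
  proof -
    have le: "real n / B \<le> 1 + \<bar>t n\<bar>" for n
    proof -
      have "real n \<le> B * (1 + \<bar>t n\<bar>)"
        using tn[of n] mult_pos_pos[OF B exp_gt_zero[of 1]] by linarith
      then show ?thesis using B by (simp add: pos_divide_le_eq mult.commute)
    qed
    have "filterlim (\<lambda>n. real n / B) at_top sequentially"
      using B by real_asymp
    then have "filterlim (\<lambda>n. 1 + \<bar>t n\<bar>) at_top sequentially"
      by (rule filterlim_at_top_mono) (use le in simp)
    then show ?thesis unfolding l_def by (rule filterlim_compose[OF ln_at_top])
  qed
  obtain g where g: "g holomorphic_on H" "\<And>z. z \<in> H \<Longrightarrow> dirichlet_L chi z = exp (g z)"
    using contractible_imp_holomorphic_log[of "dirichlet_L chi" H] holomorphic_dirichlet_L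
      convex_imp_contractible[OF H(2)] nz by (auto simp: H_def)
  \<comment> \<open>A branch of the power 1 / l n of L(z + i t_n), available because L has a
    holomorphic logarithm on the half-plane when it has no zero there.\<close>
  define F where "F n z = exp (g (z + \<i> * of_real (t n)) / of_real (l n))" for n z
  have in_H: "z + \<i> * of_real u \<in> H" if "z \<in> H" for z u using that by (simp add: H_def)
  have Re_g: "Re (g z) = ln (norm (dirichlet_L chi z))" if "z \<in> H" for z
    using g(2)[OF that] by simp
  have norm_F: "norm (F n z) = exp (ln (norm (dirichlet_L chi (z + \<i> * of_real (t n)))) / l n)" if "z \<in> H" for n z
    using Re_g[OF in_H[OF that]] by (simp add: F_def)
  obtain f r where f: "f holomorphic_on H" "strict_mono (r :: nat \<Rightarrow> nat)"
    "\<And>z. z \<in> H \<Longrightarrow> (\<lambda>n. F (r n) z) \<longlonglongrightarrow> f z"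
  proof (rule Montel[of H "range F" F])
    show "h holomorphic_on H" if "h \<in> range F" for h
    proof -
      from that obtain n where h: "h = F n" by auto
      have "(g \<circ> (\<lambda>z. z + \<i> * of_real (t n))) holomorphic_on H"
        by (rule holomorphic_on_compose_gen[OF _ g(1)]) (auto intro!: holomorphic_intros in_H)
      then have "(\<lambda>z. g (z + \<i> * of_real (t n))) holomorphic_on H" by (simp add: o_def)
      then show ?thesis unfolding h F_def using l1[of n] by (intro holomorphic_intros) auto
    qed
    fix K assume K: "compact K" "K \<subseteq> H"
    show "\<exists>M. \<forall>h\<in>range F. \<forall>z\<in>K. norm (h z) \<le> M"
    proof (cases "K = {}")
      case False
      obtain z0 where z0: "z0 \<in> K" "\<And>z. z \<in> K \<Longrightarrow> Re z0 \<le> Re z"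
        using continuous_attains_inf[OF K(1) False continuous_on_Re[OF continuous_on_id]] by auto
      obtain R where R: "\<And>z. z \<in> K \<Longrightarrow> norm z \<le> R"
        using compact_imp_bounded[OF K(1)] by (auto simp: bounded_iff)
      have b: "Re z0 > 0" using z0 K by (auto simp: H_def)
      define M where "M = q * ((R + 1) * zeta_shift (Re z0) + 1) + 1"
      have "R \<ge> 0" using R[OF z0(1)] norm_ge_zero order_trans by blast
      then have M: "M \<ge> 1" using zeta_shift_nonneg[OF b] by (simp add: M_def)
      \<comment> \<open>Linear growth in the height contributes \<open>l n\<close> to the logarithm;
        dividing by \<open>l n\<close> leaves a bound independent of n.\<close>
      have "norm (F n z) \<le> exp (ln M + 1)" if "z \<in> K" for n z
      proof -
        have zH: "z \<in> H" using that K by auto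
        let ?L = "dirichlet_L chi (z + \<i> * of_real (t n))"
        have "norm ?L \<le> (q * ((R + 1) * zeta_shift (Re z0) + 1)) * (1 + \<bar>t n\<bar>)"
          by (rule lin) (use b z0 R that in auto)
        also have "\<dots> \<le> M * (1 + \<bar>t n\<bar>)" by (intro mult_right_mono) (auto simp: M_def)
        finally have "norm ?L \<le> M * (1 + \<bar>t n\<bar>)" .
        moreover have "norm ?L > 0" using nz in_H[OF zH] by (simp add: H_def)
        ultimately have "ln (norm ?L) \<le> ln (M * (1 + \<bar>t n\<bar>))" using M by (subst ln_le_cancel_iff) auto
        also have "\<dots> = ln M + l n" using M by (simp add: ln_mult l_def)
        finally have "ln (norm ?L) / l n \<le> (ln M + l n) / l n" using l1[of n] by (intro divide_right_mono) auto
        also have "\<dots> = ln M / l n + 1" using l1[of n] by (simp add: add_divide_distrib)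
        also have "ln M / l n \<le> ln M / 1" using M l1[of n] by (intro divide_left_mono) auto
        finally show ?thesis using norm_F[OF zH] by simp
      qed
      then show ?thesis by (intro exI[of _ "exp (ln M + 1)"]) auto
    qed auto
  qed (use H in auto)
  have lr: "filterlim (\<lambda>n. l (r n)) at_top sequentially"
    using filterlim_compose[OF \<open>filterlim l at_top sequentially\<close> filterlim_subseq[OF f(2)]] .
  obtain \<sigma> where \<sigma>: "\<sigma> > 0" "\<And>s. Re s \<ge> \<sigma> \<Longrightarrow> norm (dirichlet_L chi s - 1) \<le> 1 / 2"
    using dirichlet_L_near_1 by blast
  define U where "U = {z. Re z > \<sigma>}"
  have U: "open U" "U \<subseteq> H" using \<sigma>(1) by (auto simp: U_def H_def open_halfspace_Re_gt)
  \<comment> \<open>Far to the right ln |L| is bounded by ln 2 at every height, and the divisor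
    \<open>l (r n)\<close> tends to infinity.\<close>
  have norm_f: "norm (f z) = 1" if z: "z \<in> U" for z
  proof (rule LIMSEQ_unique)
    have zH: "z \<in> H" using z U by auto
    show "(\<lambda>n. norm (F (r n) z)) \<longlonglongrightarrow> norm (f z)" by (intro tendsto_norm f zH)
    have "(\<lambda>n. ln (norm (dirichlet_L chi (z + \<i> * of_real (t (r n))))) / l (r n)) \<longlonglongrightarrow> 0"
    proof (rule Lim_null_comparison)
      show "(\<lambda>n. ln 2 / l (r n)) \<longlonglongrightarrow> 0" using lr by (rule real_tendsto_divide_at_top[OF tendsto_const])
      have "norm (ln (norm (dirichlet_L chi (z + \<i> * of_real u)))) \<le> ln 2" for u
      proof -
        define x where "x = norm (dirichlet_L chi (z + \<i> * of_real u))"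
        have "norm (dirichlet_L chi (z + \<i> * of_real u) - 1) \<le> 1 / 2"
          by (rule \<sigma>(2)) (use z in \<open>auto simp: U_def\<close>)
        then have "\<bar>x - 1\<bar> \<le> 1 / 2"
          using norm_triangle_ineq3[of "dirichlet_L chi (z + \<i> * of_real u)" 1] by (simp add: x_def)
        then have x: "1 / 2 \<le> x" "x \<le> 2" by linarith+
        then have "ln (1 / 2) \<le> ln x" "ln x \<le> ln 2" by (subst ln_le_cancel_iff; simp)+
        then show ?thesis unfolding x_def[symmetric] by (simp add: ln_div)
      qed
      then have "norm (ln (norm (dirichlet_L chi (z + \<i> * of_real (t (r n))))) / l (r n)) \<le> ln 2 / l (r n)" for n
        using l1[of "r n"] by (simp add: divide_right_mono)
      then show "\<forall>\<^sub>F n in sequentially. norm (ln (norm (dirichlet_L chi (z + \<i> * of_real (t (r n))))) / l (r n)) \<le> ln 2 / l (r n)"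
        by simp
    qed
    from tendsto_exp[OF this] show "(\<lambda>n. norm (F (r n) z)) \<longlonglongrightarrow> 1"
      by (simp add: norm_F[OF zH])
  qed
  \<comment> \<open>By the open mapping theorem a non-constant f has an open image of U, which
    cannot lie on the unit circle: a small radial displacement of a value would remain in the
    image.\<close>
  have "f constant_on H"
  proof (rule ccontr)
    assume "\<not> f constant_on H"
    then have "open (f ` U)" using open_mapping_thm[OF f(1) H(1,3) U] by blast
    moreover have zU: "of_real (\<sigma> + 1) \<in> U" by (simp add: U_def)
    ultimately obtain e where e: "e > 0" "ball (f (of_real (\<sigma> + 1))) e \<subseteq> f ` U"
      by (meson imageI open_contains_ball)
    define w where "w = f (of_real (\<sigma> + 1))"
    have w1: "norm w = 1" using norm_f[OF zU] by (simp add: w_def)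
    have "dist w (w + of_real (e / 2) * w) = e / 2" using e(1) by (simp add: dist_norm norm_mult w1)
    then have "w + of_real (e / 2) * w \<in> f ` U" using e by (auto simp: w_def)
    then have "norm (w + of_real (e / 2) * w) = 1" using norm_f by auto
    moreover have "w + of_real (e / 2) * w = of_real (1 + e / 2) * w" by (simp add: algebra_simps)
    then have "norm (w + of_real (e / 2) * w) = 1 + e / 2" using e(1) w1 by (simp only: norm_mult norm_of_real) simp
    ultimately show False using e(1) by simp
  qed
  then obtain k where "\<And>z. z \<in> H \<Longrightarrow> f z = k" by (auto simp: constant_on_def)
  moreover have "of_real (\<sigma> + 1) \<in> U" "of_real a \<in> H" using a by (auto simp: U_def H_def)
  ultimately have "norm (f (of_real a)) = 1" using norm_f U by (metis subsetD)
  \<comment> \<open>The heights were chosen so that ln |L| is at least \<epsilon> times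
    \<open>l n\<close> at real part a, which contradicts modulus 1 in the limit.\<close>
  moreover have "exp \<epsilon> \<le> norm (f (of_real a))"
  proof (rule tendsto_lowerbound)
    show "(\<lambda>n. norm (F (r n) (of_real a))) \<longlonglongrightarrow> norm (f (of_real a))"
      using \<open>of_real a \<in> H\<close> by (intro tendsto_norm f)
    have "exp \<epsilon> \<le> norm (F n (of_real a))" for n
    proof -
      let ?L = "dirichlet_L chi (of_real a + \<i> * of_real (t n))"
      have "1 * (1 + \<bar>t n\<bar>) powr \<epsilon> \<le> (real n + B * exp 1 + 1) * (1 + \<bar>t n\<bar>) powr \<epsilon>"
        using B by (intro mult_right_mono) auto
      also have "\<dots> \<le> norm ?L" using t[of n] by (simp add: L_eq)
      finally have "ln ((1 + \<bar>t n\<bar>) powr \<epsilon>) \<le> ln (norm ?L)"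
        using nz[of "of_real a + \<i> * of_real (t n)"] a by (subst ln_le_cancel_iff) auto
      then have "\<epsilon> * l n \<le> ln (norm ?L)" by (simp add: ln_powr l_def)
      then have "\<epsilon> \<le> ln (norm ?L) / l n" using l1[of n] by (simp add: field_simps)
      then show ?thesis using norm_F[OF \<open>of_real a \<in> H\<close>] by simp
    qed
    then show "\<forall>\<^sub>F n in sequentially. exp \<epsilon> \<le> norm (F (r n) (of_real a))" by simp
  qed auto
  ultimately show False using \<epsilon> by (metis exp_gt_one not_le)
qed

section \<open>Mean squares on the line Re s = 1/4\<close>

lemma partial_L_trig_polynomial:
  "partial_L N (Complex a (T * u)) =
     (\<Sum>n<N. (chi (Suc n) * of_real (real (Suc n) powr (-a))) * iexp ((- T * ln (real (Suc n))) * u))"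
  unfolding partial_L_def
proof (intro sum.cong refl)
  fix n
  have "of_nat (Suc n) powr (- Complex a (T * u)) = exp (- Complex a (T * u) * of_real (ln (real (Suc n))))"
    using Ln_of_real[of "real (Suc n)"] by (simp add: powr_def del: of_nat_Suc)
  also have "- Complex a (T * u) * of_real (ln (real (Suc n)))
      = of_real (- a * ln (real (Suc n))) + \<i> * of_real ((- T * ln (real (Suc n))) * u)"
    by (simp add: complex_eq_iff)
  also have "exp \<dots> = of_real (real (Suc n) powr (-a)) * iexp ((- T * ln (real (Suc n))) * u)"
    unfolding exp_add exp_of_real by (simp add: powr_def del: of_nat_Suc)
  finally show "chi (Suc n) * of_nat (Suc n) powr (- Complex a (T * u)) =
      (chi (Suc n) * of_real (real (Suc n) powr (-a))) * iexp ((- T * ln (real (Suc n))) * u)"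
    by (simp only: mult.assoc)
qed

text \<open>The general inequality with the first X of N frequencies as B. Each off-diagonal term is
  at most 1 / (X m^2), so the X rows together lose no more than a multiple of zeta(2), whatever N
  and X are.\<close>

lemma mean_square_partial_L_ge:
  assumes X: "X \<ge> 4" "X \<le> N"
  shows "(LINT u|std_normal_distribution. (norm (partial_L N (Complex (1/4) (real X ^ 3 * u))))\<^sup>2) \<ge>
    (\<Sum>n<X. (norm (chi (Suc n)))\<^sup>2 * real (Suc n) powr (-1/2)) - 2 * zeta_shift 1"
proof -
  define c where "c n = chi (Suc n) * of_real (real (Suc n) powr (-1/4))" for n
  define w where "w n = - (real X ^ 3) * ln (real (Suc n))" for n
  have sm: "summable (\<lambda>n. real (Suc n) powr (-2))" using summable_Suc_powr[of 1] by simp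
  have c1: "norm (c n) \<le> 1" for n
  proof -
    have "real (Suc n) powr (-1/4) \<le> real (Suc n) powr 0" by (intro powr_mono) auto
    then show ?thesis unfolding c_def norm_mult using norm_chi_le[of "Suc n"]
      by (intro mult_le_one) auto
  qed
  have c2: "(norm (c n))\<^sup>2 = (norm (chi (Suc n)))\<^sup>2 * real (Suc n) powr (-1/2)" for n
    unfolding c_def norm_mult power_mult_distrib
    by (simp add: power2_eq_square powr_add[symmetric])
  have term_le: "norm (c m) * norm (c n) * exp (- ((w m - w n)\<^sup>2) / 2) \<le> (1 / real X) * real (Suc m) powr (-2)"
    if "n < X" "m \<noteq> n" for m n
  proof -
    have w: "(w m - w n)\<^sup>2 = (real X ^ 3 * ln (real (Suc m)) - real X ^ 3 * ln (real (Suc n)))\<^sup>2"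
      unfolding w_def by (subst power2_commute) (simp add: algebra_simps)
    have "norm (c m) * norm (c n) * exp (- ((w m - w n)\<^sup>2) / 2) \<le> 1 * exp (- ((w m - w n)\<^sup>2) / 2)"
      by (intro mult_right_mono mult_le_one c1) auto
    also have "\<dots> \<le> 1 / (real X * (real (Suc m))\<^sup>2)"
      unfolding w using gaussian_offdiagonal_le[OF X(1), of "Suc n" "Suc m"] that by (simp del: of_nat_Suc)
    also have "\<dots> = (1 / real X) * real (Suc m) powr (-2)"
      by (simp add: powr_minus_divide powr_numeral del: of_nat_Suc)
    finally show ?thesis .
  qed
  have "(\<Sum>n<X. \<Sum>m\<in>{..<N} - {n}. norm (c m) * norm (c n) * exp (- ((w m - w n)\<^sup>2) / 2))
      \<le> (\<Sum>n<X. \<Sum>m\<in>{..<N} - {n}. (1 / real X) * real (Suc m) powr (-2))"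
    by (intro sum_mono term_le) auto
  also have "\<dots> \<le> (\<Sum>n<X. \<Sum>m<N. (1 / real X) * real (Suc m) powr (-2))"
    by (intro sum_mono sum_mono2) auto
  also have "\<dots> = (\<Sum>m<N. real (Suc m) powr (-2))"
    using X by (simp add: sum_divide_distrib[symmetric] del: of_nat_Suc)
  also have "\<dots> \<le> zeta_shift 1"
    unfolding zeta_shift_def using sum_le_suminf[OF sm, of "{..<N}"] by simp
  finally have err: "(\<Sum>n<X. \<Sum>m\<in>{..<N} - {n}. norm (c m) * norm (c n) * exp (- ((w m - w n)\<^sup>2) / 2)) \<le> zeta_shift 1" .
  have "partial_L N (Complex (1/4) (real X ^ 3 * u)) = (\<Sum>n<N. c n * iexp (w n * u))" for u
    unfolding partial_L_trig_polynomial c_def w_def by simp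
  moreover have "(LINT u|std_normal_distribution. (norm (\<Sum>n<N. c n * iexp (w n * u)))\<^sup>2) \<ge>
    (\<Sum>n<X. (norm (c n))\<^sup>2) -
    2 * (\<Sum>n<X. \<Sum>m\<in>{..<N} - {n}. norm (c m) * norm (c n) * exp (- ((w m - w n)\<^sup>2) / 2))"
    by (rule mean_square_trig_polynomial_ge) (use X in auto)
  ultimately show ?thesis using err by (simp only: c2)
qed

lemma continuous_on_vertical_dirichlet_L:
  "a > 0 \<Longrightarrow> continuous_on UNIV (\<lambda>u. dirichlet_L chi (Complex a (T * u)))"
  by (intro continuous_on_compose2[OF holomorphic_on_imp_continuous_on[OF holomorphic_dirichlet_L]])
     (auto simp: Complex_eq intro!: continuous_intros)

lemma mean_square_dirichlet_L_ge:
  assumes X: "X \<ge> 4"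
  shows "(LINT u|std_normal_distribution. (norm (dirichlet_L chi (Complex (1/4) (real X ^ 3 * u))))\<^sup>2) \<ge>
    (\<Sum>n<X. (norm (chi (Suc n)))\<^sup>2 * real (Suc n) powr (-1/2)) - 2 * zeta_shift 1"
proof -
  interpret real_distribution std_normal_distribution by (rule real_dist_normal_dist)
  let ?M = std_normal_distribution
  define T where "T = real X ^ 3"
  define Z where "Z = zeta_shift (1/4)"
  have Z: "Z \<ge> 0" by (simp add: Z_def zeta_shift_nonneg)
  have T: "T \<ge> 0" by (simp add: T_def)
  \<comment> \<open>The uniform bound on partial sums is linear in |u|; its square is dominated by
    this quadratic, integrable because the normal law has a second moment.\<close>
  define W where "W u = 2 * (q * (1/4 * Z + 1))\<^sup>2 + 2 * (q * T * Z)\<^sup>2 * u\<^sup>2" for u :: real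
  have bd: "(norm (partial_L N (Complex (1/4) (T * u))))\<^sup>2 \<le> W u" for N u
  proof -
    have "norm (Complex (1/4) (T * u)) \<le> 1/4 + T * \<bar>u\<bar>"
      using cmod_le[of "Complex (1/4) (T * u)"] T by (simp add: abs_mult)
    then have "q * (norm (Complex (1/4) (T * u)) * Z + 1) \<le> q * ((1/4 + T * \<bar>u\<bar>) * Z + 1)"
      using Z by (intro mult_left_mono add_right_mono mult_right_mono) auto
    moreover have "norm (partial_L N (Complex (1/4) (T * u))) \<le> q * (norm (Complex (1/4) (T * u)) * Z + 1)"
      unfolding Z_def by (rule norm_partial_L_le) auto
    ultimately have "norm (partial_L N (Complex (1/4) (T * u))) \<le> q * (1/4 * Z + 1) + q * T * Z * \<bar>u\<bar>"
      by (simp add: algebra_simps)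
    then have "(norm (partial_L N (Complex (1/4) (T * u))))\<^sup>2 \<le> (q * (1/4 * Z + 1) + q * T * Z * \<bar>u\<bar>)\<^sup>2"
      by (intro power_mono) auto
    also have "\<dots> \<le> 2 * (q * (1/4 * Z + 1))\<^sup>2 + 2 * (q * T * Z * \<bar>u\<bar>)\<^sup>2"
    proof -
      have "(x + y)\<^sup>2 \<le> 2 * x\<^sup>2 + 2 * y\<^sup>2" for x y :: real
        using zero_le_power2[of "x - y"] unfolding power2_sum power2_diff by linarith
      then show ?thesis .
    qed
    finally show ?thesis by (simp add: W_def power_mult_distrib mult.assoc)
  qed
  have lim: "(\<lambda>N. LINT u|?M. (norm (partial_L N (Complex (1/4) (T * u))))\<^sup>2)
      \<longlonglongrightarrow> (LINT u|?M. (norm (dirichlet_L chi (Complex (1/4) (T * u))))\<^sup>2)"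
  proof (rule integral_dominated_convergence)
    show "(\<lambda>u. (norm (dirichlet_L chi (Complex (1/4) (T * u))))\<^sup>2) \<in> borel_measurable ?M"
      by (simp, intro borel_measurable_continuous_onI continuous_intros continuous_on_vertical_dirichlet_L) simp
    show "(\<lambda>u. (norm (partial_L N (Complex (1/4) (T * u))))\<^sup>2) \<in> borel_measurable ?M" for N
      unfolding partial_L_trig_polynomial by measurable
    show "integrable ?M W"
      unfolding W_def using integrable_std_normal_distribution_moment[of 2]
      by (intro Bochner_Integration.integrable_add integrable_mult_right) auto
    show "AE u in ?M. (\<lambda>N. (norm (partial_L N (Complex (1/4) (T * u))))\<^sup>2)
        \<longlonglongrightarrow> (norm (dirichlet_L chi (Complex (1/4) (T * u))))\<^sup>2"
      by (intro AE_I2 tendsto_intros partial_L_tendsto) auto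
  qed (use bd in auto)
  show ?thesis
  proof (rule tendsto_lowerbound[OF lim[unfolded T_def]])
    show "\<forall>\<^sub>F N in sequentially. (\<Sum>n<X. (norm (chi (Suc n)))\<^sup>2 * real (Suc n) powr (-1/2)) - 2 * zeta_shift 1
        \<le> (LINT u|?M. (norm (partial_L N (Complex (1/4) (real X ^ 3 * u))))\<^sup>2)"
      using eventually_ge_at_top[of X] by (rule eventually_mono) (rule mean_square_partial_L_ge[OF X])
  qed simp
qed

text \<open>The exponent 1/24 doubles on squaring, and the scale X^3 turns 1/12 into X^(1/4), which
  stays below the order X^(1/2) of the lower bound. The remaining power of 1 + |u| is raised to 1 to
  have a finite mean.\<close>

lemma mean_square_dirichlet_L_le:
  assumes C: "\<And>t. norm (dirichlet_L chi (Complex (1/4) t)) \<le> C * (1 + \<bar>t\<bar>) powr (1/24)" and X: "X > 0"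
  shows "(LINT u|std_normal_distribution. (norm (dirichlet_L chi (Complex (1/4) (real X ^ 3 * u))))\<^sup>2) \<le>
     C\<^sup>2 * (LINT u|std_normal_distribution. 1 + \<bar>u\<bar>) * real X powr (1/4)"
proof -
  interpret real_distribution std_normal_distribution by (rule real_dist_normal_dist)
  let ?M = std_normal_distribution
  define T where "T = real X ^ 3"
  have T: "T \<ge> 1" using X by (simp add: T_def)
  have bd: "(norm (dirichlet_L chi (Complex (1/4) (T * u))))\<^sup>2 \<le> C\<^sup>2 * real X powr (1/4) * (1 + \<bar>u\<bar>)" for u
  proof -
    have "(norm (dirichlet_L chi (Complex (1/4) (T * u))))\<^sup>2 \<le> (C * (1 + \<bar>T * u\<bar>) powr (1/24))\<^sup>2"
      by (intro power_mono C) auto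
    also have "\<dots> = C\<^sup>2 * (1 + \<bar>T * u\<bar>) powr (1/12)"
      by (simp add: power_mult_distrib power2_eq_square powr_add[symmetric])
    also have "(1 + \<bar>T * u\<bar>) powr (1/12) \<le> (T * (1 + \<bar>u\<bar>)) powr (1/12)"
      using T by (intro powr_mono2) (auto simp: abs_mult algebra_simps)
    also have "\<dots> = T powr (1/12) * (1 + \<bar>u\<bar>) powr (1/12)"
      by (rule powr_mult)
    also have "T powr (1/12) = real X powr (1/4)"
      using powr_powr[of "real X" 3 "1/12"] X by (simp add: T_def)
    also have "(1 + \<bar>u\<bar>) powr (1/12) \<le> (1 + \<bar>u\<bar>) powr 1" by (intro powr_mono) auto
    finally show ?thesis by (simp add: mult_left_mono mult.assoc)
  qed
  have int1: "integrable ?M (\<lambda>u. 1 + \<bar>u\<bar>)"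
    using integrable_std_normal_distribution_moment[of 1] by (intro Bochner_Integration.integrable_add integrable_abs) auto
  have int2: "integrable ?M (\<lambda>u. C\<^sup>2 * real X powr (1/4) * (1 + \<bar>u\<bar>))"
    using int1 by (rule integrable_mult_right)
  have "integrable ?M (\<lambda>u. (norm (dirichlet_L chi (Complex (1/4) (T * u))))\<^sup>2)"
  proof (rule Bochner_Integration.integrable_bound[OF int2])
    show "(\<lambda>u. (norm (dirichlet_L chi (Complex (1/4) (T * u))))\<^sup>2) \<in> borel_measurable ?M"
      by (simp, intro borel_measurable_continuous_onI continuous_intros continuous_on_vertical_dirichlet_L) simp
    show "AE u in ?M. norm ((norm (dirichlet_L chi (Complex (1/4) (T * u))))\<^sup>2) \<le> norm (C\<^sup>2 * real X powr (1/4) * (1 + \<bar>u\<bar>))"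
      using bd by (intro AE_I2) (simp add: abs_mult)
  qed
  then have "(LINT u|?M. (norm (dirichlet_L chi (Complex (1/4) (T * u))))\<^sup>2)
      \<le> (LINT u|?M. C\<^sup>2 * real X powr (1/4) * (1 + \<bar>u\<bar>))"
    using int2 bd by (rule integral_mono)
  also have "\<dots> = C\<^sup>2 * real X powr (1/4) * (LINT u|?M. 1 + \<bar>u\<bar>)" by (rule integral_mult_right_zero)
  finally show ?thesis unfolding T_def by (simp add: mult_ac)
qed

text \<open>Keep only the Y integers congruent to 1 modulo q, where \<open>chi\<close> is 1; each
  contributes at least (q Y)^(-1/2).\<close>

lemma diagonal_sum_ge:
  assumes "Y > 0"
  shows "(\<Sum>n<q * Y. (norm (chi (Suc n)))\<^sup>2 * real (Suc n) powr (-1/2)) \<ge> sqrt (real (q * Y)) / q"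
proof -
  have inj: "inj_on (\<lambda>j. q * j) {..<Y}" using q_pos by (auto intro!: inj_onI)
  have x: "real (q * Y) > 0" using q_pos assms by simp
  have "sqrt (real (q * Y)) / q = real Y * real (q * Y) powr (-1/2)"
  proof -
    define z where "z = sqrt (real (q * Y))"
    have "real (q * Y) powr (-1/2) = 1 / z"
      using x powr_minus_divide[of "real (q * Y)" "1/2"] powr_half_sqrt[of "real (q * Y)"] by (simp add: z_def)
    moreover have "z * z = real q * real Y" "z > 0" using x by (auto simp: z_def)
    then have "z / q = real Y * (1 / z)" using q_pos by (simp add: field_simps)
    ultimately show ?thesis by (simp only: z_def)
  qed
  also have "\<dots> = (\<Sum>j<Y. real (q * Y) powr (-1/2))" by simp
  also have "\<dots> \<le> (\<Sum>j<Y. (norm (chi (Suc (q * j))))\<^sup>2 * real (Suc (q * j)) powr (-1/2))"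
  proof (rule sum_mono)
    fix j assume j: "j \<in> {..<Y}"
    have "chi (Suc (q * j)) = 1" using chi_add_mult_q[of "Suc 0" j] by (simp add: mult.commute)
    moreover have "q * Suc j \<le> q * Y" using j by (intro mult_left_mono) auto
    then have "Suc (q * j) \<le> q * Y" using q_pos by simp
    then have "real (q * Y) powr (-1/2) \<le> real (Suc (q * j)) powr (-1/2)"
      by (intro powr_mono2') (simp, simp only: of_nat_0_less_iff zero_less_Suc, simp only: of_nat_le_iff)
    ultimately show "real (q * Y) powr (-1/2) \<le> (norm (chi (Suc (q * j))))\<^sup>2 * real (Suc (q * j)) powr (-1/2)"
      by simp
  qed
  also have "\<dots> = (\<Sum>n\<in>(\<lambda>j. q * j) ` {..<Y}. (norm (chi (Suc n)))\<^sup>2 * real (Suc n) powr (-1/2))"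
    by (simp add: sum.reindex[OF inj])
  also have "\<dots> \<le> (\<Sum>n<q * Y. (norm (chi (Suc n)))\<^sup>2 * real (Suc n) powr (-1/2))"
    using q_pos by (intro sum_mono2) auto
  finally show ?thesis .
qed

text \<open>Without zeros, the two mean square bounds at X = q Y would keep sqrt X / q - K X^(1/4)
  bounded as Y grows.\<close>

lemma dirichlet_L_has_zero:
  obtains s where "Re s > 0" "dirichlet_L chi s = 0"
proof (rule ccontr)
  assume "\<not> thesis"
  then have "\<And>s. Re s > 0 \<Longrightarrow> dirichlet_L chi s \<noteq> 0" using that by blast
  then obtain C where C: "\<And>t. norm (dirichlet_L chi (Complex (1/4) t)) \<le> C * (1 + \<bar>t\<bar>) powr (1/24)"
    using dirichlet_L_subpolynomial[of "1/4" "1/24"] by auto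
  define K where "K = C\<^sup>2 * (LINT u|std_normal_distribution. 1 + \<bar>u\<bar>)"
  have le: "sqrt x / q - K * x powr (1/4) \<le> 2 * zeta_shift 1"
    if "x = real (q * Y)" "Y \<ge> 4" for x Y
  proof -
    have "q * Y \<ge> 1 * 4" using q_pos that by (intro mult_le_mono) auto
    then have "4 \<le> q * Y" "0 < q * Y" "0 < Y" using that q_pos by auto
    then show ?thesis
      using mean_square_dirichlet_L_ge[of "q * Y"] mean_square_dirichlet_L_le[OF C, of "q * Y"]
        diagonal_sum_ge[of Y] unfolding K_def that(1) by linarith
  qed
  have q: "real q > 0" using q_pos by simp
  have "filterlim (\<lambda>x. sqrt x / q - K * x powr (1/4)) at_top at_top" using q by real_asymp
  moreover have "filterlim (\<lambda>Y. real (q * Y)) at_top sequentially" using q by real_asymp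
  ultimately have "filterlim (\<lambda>Y. sqrt (real (q * Y)) / q - K * real (q * Y) powr (1/4)) at_top sequentially"
    by (rule filterlim_compose)
  then have "\<forall>\<^sub>F Y in sequentially. sqrt (real (q * Y)) / q - K * real (q * Y) powr (1/4) > 2 * zeta_shift 1"
    by (simp add: filterlim_at_top_dense)
  then have "\<forall>\<^sub>F Y in sequentially. False"
    using eventually_ge_at_top[of 4]
  proof eventually_elim
    case (elim Y)
    then show False using le[OF refl, of Y] by linarith
  qed
  then show False by simp
qed

end

subsection \<open>Higher derivatives near a pair of conjugate poles\<close>

text \<open>Divides out the zero at \<xi> on all of S, not only near \<xi>; n = 0 covers a non-zero
  value there. The point z0 excludes the zero function.\<close>

lemma holomorphic_factor_out_zero:
  assumes f: "f holomorphic_on S" and S: "open S" "connected S" and \<xi>: "\<xi> \<in> S"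
    and nz: "z0 \<in> S" "f z0 \<noteq> 0"
  obtains n g where "g holomorphic_on S" "\<And>w. w \<in> S \<Longrightarrow> f w = (w - \<xi>) ^ n * g w" "g \<xi> \<noteq> 0"
    "f \<xi> = 0 \<Longrightarrow> n > 0"
proof (cases "f \<xi> = 0")
  case False
  then show ?thesis using that[of f 0] f by auto
next
  case True
  then have "\<not> f constant_on S" using nz \<xi> by (metis constant_on_def)
  then obtain g0 r n where g0: "0 < n" "0 < r" "ball \<xi> r \<subseteq> S" "g0 holomorphic_on ball \<xi> r"
    "\<And>w. w \<in> ball \<xi> r \<Longrightarrow> f w = (w - \<xi>) ^ n * g0 w" "\<And>w. w \<in> ball \<xi> r \<Longrightarrow> g0 w \<noteq> 0"
    using holomorphic_factor_zero_nonconstant[OF f S \<xi> True] by metis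
  \<comment> \<open>The local cofactor g0 fills in the removable singularity of the quotient at
    \<xi>.\<close>
  define g where "g w = (if w \<in> ball \<xi> r then g0 w else f w / (w - \<xi>) ^ n)" for w
  have g_eq: "g w = f w / (w - \<xi>) ^ n" if "w \<noteq> \<xi>" for w
    using g0(5)[of w] that by (simp add: g_def)
  have "g holomorphic_on ball \<xi> r"
    using g0(4) by (rule holomorphic_transform) (simp add: g_def)
  moreover have "g holomorphic_on (S - {\<xi>})"
  proof (rule holomorphic_transform)
    show "(\<lambda>w. f w / (w - \<xi>) ^ n) holomorphic_on (S - {\<xi>})"
      by (intro holomorphic_intros holomorphic_on_subset[OF f]) auto
  qed (simp add: g_eq)
  ultimately have "g holomorphic_on (ball \<xi> r \<union> (S - {\<xi>}))"
    by (rule holomorphic_on_Un) (use S in \<open>auto intro: open_delete\<close>)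
  moreover have "ball \<xi> r \<union> (S - {\<xi>}) = S" using g0(2,3) \<xi> by auto
  ultimately have "g holomorphic_on S" by simp
  moreover have "f w = (w - \<xi>) ^ n * g w" if "w \<in> S" for w
    using g0(5)[of \<xi>] g0(2) g_eq[of w] by (cases "w = \<xi>") (auto simp: g_def)
  moreover have "g \<xi> \<noteq> 0" using g0(2,6) by (simp add: g_def)
  ultimately show ?thesis using that[of g n] g0(1) by blast
qed

lemma higher_deriv_simple_pole:
  fixes \<rho> z :: complex
  assumes "z \<noteq> \<rho>"
  shows "(deriv ^^ n) (\<lambda>z. 1 / (z - \<rho>)) z = (-1) ^ n * fact n / (z - \<rho>) ^ Suc n"
  using assms
proof (induction n arbitrary: z)
  case (Suc n)
  have "(deriv ^^ Suc n) (\<lambda>z. 1 / (z - \<rho>)) z = deriv ((deriv ^^ n) (\<lambda>z. 1 / (z - \<rho>))) z" by simp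
  also have "\<dots> = deriv (\<lambda>z. (-1) ^ n * fact n / (z - \<rho>) ^ Suc n) z"
  proof (rule deriv_cong_ev)
    have "\<forall>\<^sub>F w in nhds z. w \<in> - {\<rho>}" using Suc.prems by (intro eventually_nhds_in_open) auto
    then show "\<forall>\<^sub>F w in nhds z. (deriv ^^ n) (\<lambda>z. 1 / (z - \<rho>)) w = (-1) ^ n * fact n / (w - \<rho>) ^ Suc n"
      by eventually_elim (use Suc.IH in auto)
  qed simp
  also have "\<dots> = (-1) ^ Suc n * fact (Suc n) / (z - \<rho>) ^ Suc (Suc n)"
  proof (rule DERIV_imp_deriv)
    define w where "w = z - \<rho>"
    have w: "w \<noteq> 0" using Suc.prems by (simp add: w_def)
    have "((\<lambda>z. (-1) ^ n * fact n / (z - \<rho>) ^ Suc n) has_field_derivative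
       - ((-1) ^ n * fact n * (of_nat (Suc n) * (z - \<rho>) ^ n)) / ((z - \<rho>) ^ Suc n * (z - \<rho>) ^ Suc n)) (at z)"
      using Suc.prems by (auto intro!: derivative_eq_intros simp del: power_Suc)
    also have "- ((-1) ^ n * fact n * (of_nat (Suc n) * (z - \<rho>) ^ n)) / ((z - \<rho>) ^ Suc n * (z - \<rho>) ^ Suc n)
        = (-1) ^ Suc n * fact (Suc n) / (z - \<rho>) ^ Suc (Suc n)"
      unfolding w_def[symmetric] using w by (simp add: field_simps)
    finally show "((\<lambda>z. (-1) ^ n * fact n / (z - \<rho>) ^ Suc n) has_field_derivative
       (-1) ^ Suc n * fact (Suc n) / (z - \<rho>) ^ Suc (Suc n)) (at z)" .
  qed
  finally show ?case .
qed simp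

text \<open>Real derivatives of \<open>log_L\<close> are read off the complex derivatives of Ln L
  this way. Openness of U makes the induction hypothesis hold near s, as differentiating it
  requires.\<close>

lemma higher_deriv_Re_of_real:
  fixes f :: "complex \<Rightarrow> complex" and u :: "real \<Rightarrow> real"
  assumes f: "f holomorphic_on U" and U: "open U"
    and u: "\<And>x. of_real x \<in> U \<Longrightarrow> u x = Re (f (of_real x))" and s: "of_real s \<in> U"
  shows "(deriv ^^ k) u s = Re ((deriv ^^ k) f (of_real s))"
  using s
proof (induction k arbitrary: s)
  case (Suc k)
  have "open ((of_real :: real \<Rightarrow> complex) -` U)"
    by (intro open_vimage U continuous_intros)
  then have "\<forall>\<^sub>F x in nhds s. x \<in> (of_real :: real \<Rightarrow> complex) -` U"
    using Suc.prems by (intro eventually_nhds_in_open) auto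
  then have "\<forall>\<^sub>F x in nhds s. (deriv ^^ k) u x = Re ((deriv ^^ k) f (of_real x))"
    by eventually_elim (use Suc.IH in auto)
  then have "deriv ((deriv ^^ k) u) s = deriv (\<lambda>x. Re ((deriv ^^ k) f (of_real x))) s"
    by (rule deriv_cong_ev) simp
  also have "\<dots> = Re ((deriv ^^ Suc k) f (of_real s))"
  proof (rule DERIV_imp_deriv)
    have "((deriv ^^ k) f has_field_derivative (deriv ^^ Suc k) f (of_real s)) (at (of_real s))"
      using has_field_derivative_higher_deriv[OF f U Suc.prems] .
    then have "((\<lambda>x. (deriv ^^ k) f (of_real x)) has_vector_derivative (deriv ^^ Suc k) f (of_real s)) (at s)"
      by (rule has_vector_derivative_real_field)
    then have "((\<lambda>x. Re ((deriv ^^ k) f (of_real x))) has_vector_derivative Re ((deriv ^^ Suc k) f (of_real s))) (at s)"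
      by (rule bounded_linear.has_vector_derivative[OF bounded_linear_Re])
    then show "((\<lambda>x. Re ((deriv ^^ k) f (of_real x))) has_real_derivative Re ((deriv ^^ Suc k) f (of_real s))) (at s)"
      by (simp add: has_real_derivative_iff_has_vector_derivative)
  qed
  finally show ?case by simp
qed (use u in simp)

lemma cos_scaled_attains_pm1:
  fixes lo hi :: real
  assumes "N * (hi - lo) \<ge> 4 * pi" "N > 0"
  obtains t1 t2 where "lo \<le> t1" "t1 \<le> hi" "cos (N * t1) = 1" "lo \<le> t2" "t2 \<le> hi" "cos (N * t2) = -1"
proof -
  \<comment> \<open>The least multiple of 2 pi above N * lo gives cosine 1, and adding pi gives -1;
    both fit into a length of 4 pi.\<close>
  define j where "j = \<lceil>N * lo / (2 * pi)\<rceil>"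
  define x where "x = 2 * pi * real_of_int j"
  have "N * lo / (2 * pi) \<le> real_of_int j" "real_of_int j < N * lo / (2 * pi) + 1"
    unfolding j_def by linarith+
  then have x: "N * lo \<le> x" "x < N * lo + 2 * pi"
    unfolding x_def by (simp_all add: field_simps)
  have "cos x = 1" unfolding x_def by (rule cos_int_2pin)
  moreover have "cos (x + pi) = -1" using \<open>cos x = 1\<close> by simp
  moreover have "N * hi \<ge> N * lo + 4 * pi" using assms by (simp add: algebra_simps)
  moreover have "N * (x / N) = x" "N * ((x + pi) / N) = x + pi" using assms(2) by simp_all
  moreover have "lo \<le> x / N" "x / N \<le> hi" "lo \<le> (x + pi) / N" "(x + pi) / N \<le> hi"
    using x assms(2) pi_gt_zero \<open>N * hi \<ge> N * lo + 4 * pi\<close>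
    by (simp_all add: pos_le_divide_eq pos_divide_le_eq mult.commute)
  ultimately show ?thesis using that[of "x / N" "(x + pi) / N"] by simp
qed

lemma Re_inverse_power_Arg:
  assumes "z \<noteq> 0"
  shows "Re (1 / z ^ k) = cos (real k * Arg z) / norm z ^ k"
proof -
  have "z ^ k = of_real (norm z ^ k) * cis (real k * Arg z)"
    using rcis_cmod_Arg[of z] DeMoivre2[of "norm z" "Arg z" k] by (simp add: rcis_def)
  then have "1 / z ^ k = of_real (1 / norm z ^ k) * cis (- (real k * Arg z))"
    using assms by (simp add: divide_simps cis_mult)
  then have "Re (1 / z ^ k) = Re (of_real (1 / norm z ^ k) * cis (- (real k * Arg z)))" by (rule arg_cong)
  then show ?thesis by simp
qed

text \<open>Both points have the same non-zero imaginary part, so equal arguments force equal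
  moduli.\<close>

lemma Arg_real_translate_inj:
  assumes "Im \<rho> \<noteq> 0" "Arg (of_real s - \<rho>) = Arg (of_real s' - \<rho>)"
  shows "s = s'"
proof -
  define z z' where "z = of_real s - \<rho>" and "z' = of_real s' - \<rho>"
  define t where "t = Arg z"
  have z: "z = rcis (norm z) t" "z' = rcis (norm z') t"
    using assms(2) rcis_cmod_Arg[of z] rcis_cmod_Arg[of z'] by (simp_all add: z_def z'_def t_def)
  have im: "Im z = - Im \<rho>" "Im z' = - Im \<rho>" by (simp_all add: z_def z'_def)
  have 1: "Im z = norm z * sin t" "Im z' = norm z' * sin t"
    using arg_cong[OF z(1), of Im] arg_cong[OF z(2), of Im] by simp_all
  then have "norm z = norm z'" using im assms(1) by (metis mult_eq_0_iff mult_right_cancel neg_0_equal_iff_equal)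
  then have "z = z'" using z by metis
  then show ?thesis by (simp add: z_def z'_def)
qed

text \<open>On the real axis the two poles contribute a multiple of \<^term>\<open>cos (Suc n * Arg (s - \<rho>))\<close> to the
  \<^term>\<open>n\<close>-th derivative, which oscillates faster and faster in \<^term>\<open>s\<close> and dominates
  the contribution of \<^term>\<open>h\<close>, whose radius of convergence is larger.\<close>
lemma higher_deriv_conjugate_poles_zero:
  fixes \<rho> :: complex and s1 \<delta> :: real and m1 m2 :: nat
  assumes \<rho>: "Im \<rho> \<noteq> 0" and \<delta>: "\<delta> > 0" and m1: "m1 > 0"
    and h: "h holomorphic_on ball (of_real s1) (norm (of_real s1 - \<rho>) + 3 * \<delta>)"
  obtains n s where "\<bar>s - s1\<bar> < \<delta>"
    "Re ((deriv ^^ n) (\<lambda>z. of_nat m1 / (z - \<rho>) + of_nat m2 / (z - cnj \<rho>) + h z) (of_real s)) = 0"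
proof -
  define r where "r = norm (of_real s1 - \<rho>)"
  define B where "B = ball (complex_of_real s1) (r + 3 * \<delta>)"
  define V where "V = B - {\<rho>, cnj \<rho>}"
  define \<phi> where "\<phi> = (\<lambda>z. of_nat m1 / (z - \<rho>) + of_nat m2 / (z - cnj \<rho>) + h z)"
  define m where "m = real m1 + real m2"
  have m: "m > 0" using m1 by (simp add: m_def)
  have r0: "r > 0" using \<rho> by (auto simp: r_def complex_eq_iff)
  have hB: "h holomorphic_on B" using h by (simp add: B_def r_def)
  have V: "open V" "V \<subseteq> B" by (auto simp: V_def B_def intro!: open_Diff)
  have hV: "h holomorphic_on V" using hB V(2) holomorphic_on_subset by blast
  have \<phi>V: "\<phi> holomorphic_on V"
    unfolding \<phi>_def by (intro holomorphic_intros hV) (auto simp: V_def)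
  have inV: "of_real s \<in> V" if "\<bar>s - s1\<bar> < \<delta>" for s
  proof -
    have "dist (complex_of_real s1) (of_real s) < \<delta>"
      using that by (simp add: dist_norm norm_minus_commute flip: of_real_diff)
    then have "of_real s \<in> B" using r0 \<delta> by (simp add: B_def)
    then show ?thesis using \<rho> by (auto simp: V_def complex_eq_iff)
  qed
  have compact_h: "compact (cball (complex_of_real s1) (r + 5 / 2 * \<delta>))" by simp
  have subB: "cball (complex_of_real s1) (r + 5 / 2 * \<delta>) \<subseteq> B" using \<delta> by (auto simp: B_def)
  obtain M where M: "\<And>z. z \<in> cball (complex_of_real s1) (r + 5 / 2 * \<delta>) \<Longrightarrow> norm (h z) \<le> M"
    using compact_imp_bounded[OF compact_continuous_image[OF continuous_on_subset[OF
        holomorphic_on_imp_continuous_on[OF hB] subB] compact_h]]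
    unfolding bounded_iff by blast
  have "norm (h (of_real s1)) \<le> M" by (rule M) (use r0 \<delta> in auto)
  then have M0: "M \<ge> 0" using norm_ge_zero order_trans by blast
  \<comment> \<open>A radius strictly above r + \<delta>, which bounds the distance from s to
    \<rho>, while the disc of radius R' about s stays where h is bounded by M. Cauchy's estimate
    then makes the contribution of h smaller by the factor ((r + \<delta>) / R')^n.\<close>
  define R' where "R' = r + 3 / 2 * \<delta>"
  have R': "R' > 0" "r + \<delta> < R'" using r0 \<delta> by (auto simp: R'_def)
  have h_bound: "norm ((deriv ^^ n) h (of_real s)) \<le> fact n * M / R' ^ n" if s: "\<bar>s - s1\<bar> < \<delta>" for n s
  proof (rule Cauchy_inequality)
    have d: "dist (complex_of_real s1) (of_real s) < \<delta>"
      using that by (simp add: dist_norm norm_minus_commute flip: of_real_diff)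
    have sub: "cball (complex_of_real s) R' \<subseteq> cball (of_real s1) (r + 5 / 2 * \<delta>)"
    proof
      fix z assume "z \<in> cball (complex_of_real s) R'"
      then have "dist (complex_of_real s) z \<le> R'" by simp
      moreover have "dist (complex_of_real s1) z \<le> dist (complex_of_real s1) (of_real s) + dist (of_real s) z"
        by (rule dist_triangle)
      ultimately show "z \<in> cball (of_real s1) (r + 5 / 2 * \<delta>)" using d by (simp add: R'_def)
    qed
    show "continuous_on (cball (complex_of_real s) R') h"
      using sub subB by (intro continuous_on_subset[OF holomorphic_on_imp_continuous_on[OF hB]]) auto
    show "h holomorphic_on ball (complex_of_real s) R'"
      using sub subB ball_subset_cball by (intro holomorphic_on_subset[OF hB]) blast
    show "norm (h z) \<le> M" if "norm (of_real s - z) = R'" for z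
      by (rule M, rule subsetD[OF sub]) (use that in \<open>simp add: dist_norm\<close>)
  qed (use R' in auto)
  \<comment> \<open>At a real s the two pole terms are multiples of conjugate numbers, so their real
    parts agree and the multiplicities enter only through their sum m.\<close>
  have deriv_\<phi>: "Re ((deriv ^^ n) \<phi> (of_real s)) =
      (-1) ^ n * fact n * (m * cos (real (Suc n) * Arg (of_real s - \<rho>)) / norm (of_real s - \<rho>) ^ Suc n)
      + Re ((deriv ^^ n) h (of_real s))" if s: "\<bar>s - s1\<bar> < \<delta>" for n s
  proof -
    have p1: "(\<lambda>z. of_nat m1 * (1 / (z - \<rho>))) holomorphic_on V"
      and p2: "(\<lambda>z. of_nat m2 * (1 / (z - cnj \<rho>))) holomorphic_on V"
      and q1: "(\<lambda>z. 1 / (z - \<rho>)) holomorphic_on V" and q2: "(\<lambda>z. 1 / (z - cnj \<rho>)) holomorphic_on V"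
      by (auto intro!: holomorphic_intros simp: V_def)
    have \<phi>_eq: "\<phi> = (\<lambda>z. (of_nat m1 * (1 / (z - \<rho>)) + of_nat m2 * (1 / (z - cnj \<rho>))) + h z)"
      by (simp add: \<phi>_def)
    have Re_scale: "Re (of_real c * z) = c * Re z" for c z by simp
    have ne: "complex_of_real s \<noteq> \<rho>" "complex_of_real s \<noteq> cnj \<rho>" using \<rho> by (auto simp: complex_eq_iff)
    have "(deriv ^^ n) \<phi> (of_real s) = (of_nat m1 * ((-1) ^ n * fact n / (of_real s - \<rho>) ^ Suc n)
        + of_nat m2 * ((-1) ^ n * fact n / (of_real s - cnj \<rho>) ^ Suc n)) + (deriv ^^ n) h (of_real s)"
      unfolding \<phi>_eq
      by (simp only: higher_deriv_add[OF holomorphic_on_add[OF p1 p2] hV V(1) inV[OF s]]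
          higher_deriv_add[OF p1 p2 V(1) inV[OF s]]
          higher_deriv_cmult[OF q1 inV[OF s] V(1)] higher_deriv_cmult[OF q2 inV[OF s] V(1)]
          higher_deriv_simple_pole[OF ne(1)] higher_deriv_simple_pole[OF ne(2)])
    also have "of_nat m1 * ((-1) ^ n * fact n / (of_real s - \<rho>) ^ Suc n)
        + of_nat m2 * ((-1) ^ n * fact n / (of_real s - cnj \<rho>) ^ Suc n)
      = of_real ((-1) ^ n * fact n) *
         (of_real (real m1) * (1 / (of_real s - \<rho>) ^ Suc n) + of_real (real m2) * cnj (1 / (of_real s - \<rho>) ^ Suc n))"
      by (simp add: field_simps)
    also have "Re (\<dots> + (deriv ^^ n) h (of_real s)) = (-1) ^ n * fact n * (m * Re (1 / (of_real s - \<rho>) ^ Suc n))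
       + Re ((deriv ^^ n) h (of_real s))"
      unfolding m_def by (simp only: Re_scale plus_complex.sel cnj.sel distrib_right)
    also have "Re (1 / (of_real s - \<rho>) ^ Suc n) = cos (real (Suc n) * Arg (of_real s - \<rho>)) / norm (of_real s - \<rho>) ^ Suc n"
      using ne by (intro Re_inverse_power_Arg) simp
    finally show ?thesis by (simp add: mult.assoc)
  qed
  define \<theta> where "\<theta> s = Arg (of_real s - \<rho>)" for s
  have cont_\<theta>: "continuous_on {s1..s1 + \<delta> / 2} \<theta>"
    unfolding \<theta>_def
    by (intro continuous_on_compose2[OF continuous_on_Arg] continuous_intros)
       (use \<rho> in \<open>auto simp: complex_nonpos_Reals_iff\<close>)
  define lo hi where "lo = min (\<theta> s1) (\<theta> (s1 + \<delta> / 2))" and "hi = max (\<theta> s1) (\<theta> (s1 + \<delta> / 2))"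
  have "\<theta> s1 \<noteq> \<theta> (s1 + \<delta> / 2)"
    using Arg_real_translate_inj[OF \<rho>, of s1 "s1 + \<delta> / 2"] \<delta> by (auto simp: \<theta>_def)
  then have lohi: "lo < hi" by (auto simp: lo_def hi_def)
  have attain: "\<exists>s\<in>{s1..s1 + \<delta> / 2}. \<theta> s = t" if "lo \<le> t" "t \<le> hi" for t
  proof (cases "\<theta> s1 \<le> \<theta> (s1 + \<delta> / 2)")
    case True
    then show ?thesis using IVT'[of \<theta> s1 t "s1 + \<delta> / 2"] cont_\<theta> that \<delta> by (auto simp: lo_def hi_def)
  next
    case False
    then show ?thesis using IVT2'[of \<theta> "s1 + \<delta> / 2" t s1] cont_\<theta> that \<delta> by (auto simp: lo_def hi_def)
  qed
  have "\<forall>\<^sub>F n in sequentially. real (Suc n) * (hi - lo) \<ge> 4 * pi"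
    using lohi by real_asymp
  moreover have "\<forall>\<^sub>F n in sequentially. M * (r + \<delta>) * ((r + \<delta>) / R') ^ n < m"
  proof -
    have "(\<lambda>n. ((r + \<delta>) / R') ^ n) \<longlonglongrightarrow> 0"
      using R' r0 \<delta> by (intro LIMSEQ_power_zero) auto
    then have "(\<lambda>n. M * (r + \<delta>) * ((r + \<delta>) / R') ^ n) \<longlonglongrightarrow> 0" by (rule tendsto_mult_right_zero)
    then show ?thesis using m by (rule order_tendstoD)
  qed
  ultimately have "\<forall>\<^sub>F n in sequentially. real (Suc n) * (hi - lo) \<ge> 4 * pi \<and> M * (r + \<delta>) * ((r + \<delta>) / R') ^ n < m"
    by (rule eventually_conj)
  then obtain n where n: "real (Suc n) * (hi - lo) \<ge> 4 * pi" "M * (r + \<delta>) * ((r + \<delta>) / R') ^ n < m"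
    by (auto simp: eventually_sequentially)
  define \<psi> where "\<psi> s = (-1) ^ n * Re ((deriv ^^ n) \<phi> (of_real s))" for s
  \<comment> \<open>Rescaled by its size, the derivative differs from m times a cosine by less than
    m, so its sign is known wherever the cosine is 1 or -1.\<close>
  have \<psi>: "norm (of_real s - \<rho>) ^ Suc n * \<psi> s / fact n - m * cos (real (Suc n) * \<theta> s) \<in> {-m<..<m}"
    if "s \<in> {s1..s1 + \<delta> / 2}" for s
  proof -
    have s: "\<bar>s - s1\<bar> < \<delta>" using that \<delta> by auto
    define w where "w = norm (of_real s - \<rho>)"
    have w0: "w > 0" using \<rho> by (auto simp: w_def complex_eq_iff)
    have "w \<le> norm (complex_of_real s1 - \<rho>) + norm (complex_of_real (s - s1))"
      unfolding w_def using norm_triangle_ineq[of "complex_of_real s1 - \<rho>" "complex_of_real (s - s1)"] by simp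
    then have w1: "w \<le> r + \<delta>" using s by (simp add: r_def del: of_real_diff)
    have "w ^ Suc n * \<psi> s / fact n - m * cos (real (Suc n) * \<theta> s) = (-1) ^ n * w ^ Suc n / fact n * Re ((deriv ^^ n) h (of_real s))"
      unfolding \<psi>_def deriv_\<phi>[OF s] w_def[symmetric] \<theta>_def[symmetric] using w0
      by (simp add: distrib_left del: power_Suc of_nat_Suc) (simp add: mult.assoc[symmetric] power_mult_distrib[symmetric] add_divide_distrib
          mult.commute[of "w ^ Suc n"] del: power_Suc of_nat_Suc)
    moreover have "\<bar>(-1) ^ n * w ^ Suc n / fact n * Re ((deriv ^^ n) h (of_real s))\<bar> < m"
    proof -
      have "\<bar>(-1) ^ n * w ^ Suc n / fact n * Re ((deriv ^^ n) h (of_real s))\<bar>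
        = w ^ Suc n / fact n * \<bar>Re ((deriv ^^ n) h (of_real s))\<bar>"
        using w0 by (simp add: abs_mult del: power_Suc)
      also have "\<dots> \<le> (r + \<delta>) ^ Suc n / fact n * (fact n * M / R' ^ n)"
        using w0 w1 order.trans[OF abs_Re_le_cmod h_bound[OF s]]
        by (intro mult_mono divide_right_mono power_mono) auto
      also have "\<dots> = M * (r + \<delta>) * ((r + \<delta>) / R') ^ n"
        by (simp add: power_divide)
      finally show ?thesis using n(2) by simp
    qed
    ultimately show ?thesis unfolding w_def[symmetric] greaterThanLessThan_iff by linarith
  qed
  have pos: "norm (of_real s - \<rho>) ^ Suc n / fact n > 0" for s
    using \<rho> by (auto simp: complex_eq_iff)
  obtain t1 t2 where t: "lo \<le> t1" "t1 \<le> hi" "cos (real (Suc n) * t1) = 1" "lo \<le> t2" "t2 \<le> hi" "cos (real (Suc n) * t2) = -1"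
    using cos_scaled_attains_pm1[OF n(1)] by auto
  obtain a where a: "a \<in> {s1..s1 + \<delta> / 2}" "\<theta> a = t1" using attain t by blast
  obtain b where b: "b \<in> {s1..s1 + \<delta> / 2}" "\<theta> b = t2" using attain t by blast
  have "(norm (of_real a - \<rho>) ^ Suc n / fact n) * \<psi> a > 0"
    using \<psi>[OF a(1)] unfolding a(2) t(3) by simp
  then have \<psi>a: "\<psi> a > 0" using pos[of a] by (simp only: zero_less_mult_pos)
  have "(norm (of_real b - \<rho>) ^ Suc n / fact n) * (- \<psi> b) > 0"
    using \<psi>[OF b(1)] unfolding b(2) t(6) by simp
  then have \<psi>b: "\<psi> b < 0" using pos[of b] by (metis zero_less_mult_pos neg_0_less_iff_less)
  have "continuous_on {s1..s1 + \<delta> / 2} \<psi>"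
    unfolding \<psi>_def
    by (intro continuous_intros continuous_on_compose2[OF holomorphic_on_imp_continuous_on[OF holomorphic_higher_deriv[OF \<phi>V V(1)]]])
       (use inV \<delta> in auto)
  then have "connected (\<psi> ` {s1..s1 + \<delta> / 2})" by (intro connected_continuous_image) auto
  then have "0 \<in> \<psi> ` {s1..s1 + \<delta> / 2}"
    using a(1) b(1) \<psi>a \<psi>b connectedD_interval[of "\<psi> ` {s1..s1 + \<delta> / 2}" "\<psi> b" "\<psi> a" 0] by auto
  then obtain s where s: "s \<in> {s1..s1 + \<delta> / 2}" "\<psi> s = 0" by auto
  then have "\<bar>s - s1\<bar> < \<delta>" "Re ((deriv ^^ n) \<phi> (of_real s)) = 0" using \<delta> by (auto simp: \<psi>_def)
  then show ?thesis using that unfolding \<phi>_def by blast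
qed

subsection \<open>Density of the zeros of the derivatives\<close>

text \<open>The perpendicular bisector of z and w meets the real axis in at most one point unless it
  is the real axis, that is, unless w is \<open>cnj z\<close>.\<close>

lemma equidistant_real_points_finite:
  fixes z w :: complex
  assumes "w \<noteq> z" "w \<noteq> cnj z"
  shows "finite {s. norm (of_real s - z) = norm (of_real s - w)}"
proof -
  have eq: "2 * s * (Re w - Re z) = (norm w)\<^sup>2 - (norm z)\<^sup>2"
    if "norm (of_real s - z) = norm (of_real s - w)" for s
    using arg_cong[OF that, of "\<lambda>x. x\<^sup>2"] unfolding cmod_power2 by (simp add: power2_eq_square algebra_simps)
  show ?thesis
  proof (cases "Re w = Re z")
    case True
    have "norm w \<noteq> norm z"
    proof
      assume "norm w = norm z"
      then have "(Im w)\<^sup>2 = (Im z)\<^sup>2" using True by (simp add: cmod_def)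
      then have "Im w = Im z \<or> Im w = - Im z" by (simp add: power2_eq_iff)
      then show False using True assms by (auto simp: complex_eq_iff)
    qed
    then have "{s. norm (of_real s - z) = norm (of_real s - w)} = {}" using eq True by auto
    then show ?thesis by simp
  next
    case False
    have "{s. norm (of_real s - z) = norm (of_real s - w)} \<subseteq> {((norm w)\<^sup>2 - (norm z)\<^sup>2) / (2 * (Re w - Re z))}"
      using eq False by (auto simp: field_simps)
    then show ?thesis by (rule finite_subset) simp
  qed
qed

section \<open>A zero of some derivative near a given point\<close>

context real_nonprincipal_character
begin

lemma log_L_deriv_zero_in_interval:
  assumes nonreal: "\<And>s. Re s > 0 \<Longrightarrow> dirichlet_L chi s = 0 \<Longrightarrow> Im s \<noteq> 0"
    and \<rho>0: "Re \<rho>0 > 0" "dirichlet_L chi \<rho>0 = 0"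
    and s0: "norm (of_real s0 - \<rho>0) < s0" and e: "e > 0" "e \<le> s0 - 1"
  obtains k s where "\<bar>s - s0\<bar> < e" "(deriv ^^ Suc k) (log_L chi) s = 0"
proof -
  define L where "L = dirichlet_L chi"
  define H where "H = {s. Re s > 0}"
  have H: "open H" "connected H"
    by (auto simp: H_def open_halfspace_Re_gt convex_halfspace_Re_gt convex_connected)
  have L: "L holomorphic_on H" unfolding L_def H_def by (rule holomorphic_dirichlet_L)
  have L2: "2 \<in> H" "L 2 \<noteq> 0"
    using nonreal[of 2] by (auto simp: H_def L_def)
  \<comment> \<open>The closed disc of radius t about s0 contains \<rho>0 and stays in Re > 0; by
    compactness it holds only finitely many zeros of L.\<close>
  obtain t where t: "norm (of_real s0 - \<rho>0) < t" "t < s0" using s0 dense by blast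
  define K where "K = cball (complex_of_real s0) t"
  have KH: "K \<subseteq> H"
  proof
    fix z assume "z \<in> K"
    then have "norm (of_real s0 - z) \<le> t" by (simp add: K_def dist_norm)
    then have "\<bar>Re (of_real s0 - z)\<bar> \<le> t" using abs_Re_le_cmod order_trans by blast
    then show "z \<in> H" using t by (simp add: H_def)
  qed
  define Z where "Z = {z \<in> K. L z = 0}"
  have \<rho>0Z: "\<rho>0 \<in> Z" using \<rho>0 t by (simp add: Z_def K_def L_def dist_norm)
  have "\<not> L constant_on H"
    using L2 \<rho>0 unfolding constant_on_def H_def L_def by (metis mem_Collect_eq)
  then have finZ: "finite Z"
    unfolding Z_def by (intro holomorphic_compact_finite_zeros[OF L H _ KH]) (auto simp: K_def)
  define gap where "gap = t - norm (of_real s0 - \<rho>0)"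
  define \<eta> where "\<eta> = min e (gap / 4)"
  have gap: "gap > 0" using t by (simp add: gap_def)
  then have \<eta>: "\<eta> > 0" "\<eta> \<le> e" "\<eta> \<le> gap / 4" using e unfolding \<eta>_def by linarith+
  \<comment> \<open>Points equidistant from zeros that are not conjugate. Avoiding them makes the
    nearest zero to s1 unique up to conjugation.\<close>
  define bad where "bad = (\<Union>z\<in>Z. \<Union>w\<in>Z - {z, cnj z}. {s. norm (of_real s - z) = norm (of_real s - w)})"
  have "finite bad"
    unfolding bad_def using finZ equidistant_real_points_finite by auto
  moreover have "infinite {s0 - \<eta><..<s0 + \<eta>}" using \<eta> by (intro infinite_Ioo) auto
  ultimately obtain s1 where s1: "s1 \<in> {s0 - \<eta><..<s0 + \<eta>}" "s1 \<notin> bad"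
    using finite_subset by (metis subsetI)
  obtain \<rho> where \<rho>: "\<rho> \<in> Z" "\<And>z. z \<in> Z \<Longrightarrow> norm (of_real s1 - \<rho>) \<le> norm (of_real s1 - z)"
    using ex_min_if_finite[of "(\<lambda>z. norm (of_real s1 - z)) ` Z"] finZ \<rho>0Z
    by (auto simp: not_less)
  define r where "r = norm (of_real s1 - \<rho>)"
  define Z' where "Z' = Z - {\<rho>, cnj \<rho>}"
  have Z': "r < norm (of_real s1 - w)" if "w \<in> Z'" for w
  proof -
    have "norm (of_real s1 - \<rho>) \<noteq> norm (of_real s1 - w)"
      using s1(2) that \<rho>(1) unfolding bad_def Z'_def by blast
    moreover have "r \<le> norm (of_real s1 - w)" using \<rho>(2)[of w] that by (simp add: Z'_def r_def)
    ultimately show ?thesis by (simp add: r_def)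
  qed
  \<comment> \<open>The three kinds of bounds on \<delta> keep s within \<eta> of s0, keep the
    enlarged disc B inside K (2 \<eta> and 3 \<delta> use half of \<open>gap\<close> each), and keep
    all other zeros outside B.\<close>
  define D where "D = insert (\<eta> - \<bar>s1 - s0\<bar>) (insert (gap / 6) ((\<lambda>w. (norm (of_real s1 - w) - r) / 3) ` Z'))"
  have D: "finite D" "D \<noteq> {}" using finZ by (auto simp: D_def Z'_def)
  define \<delta> where "\<delta> = Min D"
  have "\<delta> \<in> D" unfolding \<delta>_def using D by (rule Min_in)
  then have \<delta>0: "\<delta> > 0" using gap s1(1) Z' by (auto simp: D_def abs_if)
  have \<delta>_le: "\<delta> \<le> d" if "d \<in> D" for d unfolding \<delta>_def using D that by (intro Min_le)
  have \<delta>1: "\<delta> \<le> \<eta> - \<bar>s1 - s0\<bar>" "\<delta> \<le> gap / 6" by (rule \<delta>_le, simp add: D_def)+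
  have \<delta>2: "r + 3 * \<delta> \<le> norm (of_real s1 - w)" if "w \<in> Z'" for w
    using \<delta>_le[of "(norm (of_real s1 - w) - r) / 3"] that by (auto simp: D_def)
  define B where "B = ball (complex_of_real s1) (r + 3 * \<delta>)"
  have d01: "dist (complex_of_real s0) (of_real s1) < \<eta>"
    using s1(1) by (auto simp: dist_real_def)
  have r_le: "r \<le> norm (of_real s0 - \<rho>0) + \<eta>"
  proof -
    have "r \<le> dist (of_real s1) \<rho>0" using \<rho>(2)[OF \<rho>0Z] by (simp add: r_def dist_norm)
    also have "\<dots> \<le> dist (complex_of_real s0) (of_real s1) + dist (of_real s0) \<rho>0" by (rule dist_triangle3)
    finally show ?thesis using d01 by (simp add: dist_norm)
  qed
  have BK: "B \<subseteq> K"
  proof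
    fix z assume "z \<in> B"
    then have "dist (complex_of_real s1) z < r + 3 * \<delta>" by (simp add: B_def)
    moreover have "dist (complex_of_real s0) z \<le> dist (complex_of_real s0) (of_real s1) + dist (of_real s1) z"
      by (rule dist_triangle)
    ultimately have "dist (complex_of_real s0) z < \<eta> + (r + 3 * \<delta>)" using d01 by linarith
    also have "\<dots> \<le> t" using r_le \<delta>1(2) \<eta>(3) gap unfolding gap_def by argo
    finally show "z \<in> K" by (simp add: K_def)
  qed
  have B: "open B" "B \<subseteq> H" using BK KH by (auto simp: B_def)
  have zeros_B: "z = \<rho> \<or> z = cnj \<rho>" if "z \<in> B" "L z = 0" for z
  proof (rule ccontr)
    assume "\<not> ?thesis"
    then have "z \<in> Z'" using that BK by (auto simp: Z'_def Z_def)
    then show False using \<delta>2[of z] that(1) by (simp add: B_def dist_norm)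
  qed
  have \<rho>H: "\<rho> \<in> H" "L \<rho> = 0" using \<rho>(1) KH by (auto simp: Z_def)
  have Im_\<rho>: "Im \<rho> \<noteq> 0" using nonreal[of \<rho>] \<rho>H by (simp add: H_def L_def)
  obtain m1 g1 where g1: "g1 holomorphic_on H" "\<And>z. z \<in> H \<Longrightarrow> L z = (z - \<rho>) ^ m1 * g1 z" "g1 \<rho> \<noteq> 0" "m1 > 0"
    using holomorphic_factor_out_zero[OF L H \<rho>H(1) L2] \<rho>H(2) by metis
  have c\<rho>H: "cnj \<rho> \<in> H" using \<rho>H by (simp add: H_def)
  \<comment> \<open>The point \<rho> is the witness here: g1 does not vanish at it, so g1 is not
    identically zero.\<close>
  obtain m2 g2 where g2: "g2 holomorphic_on H" "\<And>z. z \<in> H \<Longrightarrow> g1 z = (z - cnj \<rho>) ^ m2 * g2 z" "g2 (cnj \<rho>) \<noteq> 0"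
    using holomorphic_factor_out_zero[OF g1(1) H c\<rho>H \<rho>H(1) g1(3)] by metis
  have L_eq: "L z = (z - \<rho>) ^ m1 * ((z - cnj \<rho>) ^ m2 * g2 z)" if "z \<in> H" for z
    using g1(2) g2(2) that by simp
  have g2_nz: "g2 z \<noteq> 0" if "z \<in> B" for z
  proof
    assume 0: "g2 z = 0"
    have zH: "z \<in> H" using that B by auto
    then have "L z = 0" using L_eq 0 by simp
    then have "z = \<rho> \<or> z = cnj \<rho>" using zeros_B that by blast
    then show False using 0 g2(3) g1(3) g2(2)[OF zH] by auto
  qed
  \<comment> \<open>What remains of L'/L after removing the two poles; it is holomorphic on B
    because g2 has no zero there.\<close>
  define h where "h z = deriv g2 z / g2 z" for z
  have h: "h holomorphic_on B"
    unfolding h_def using g2_nz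
    by (intro holomorphic_intros holomorphic_on_subset[OF g2(1) B(2)]
          holomorphic_on_subset[OF holomorphic_deriv[OF g2(1) H(1)] B(2)]) auto
  define \<phi> where "\<phi> = (\<lambda>z. of_nat m1 / (z - \<rho>) + of_nat m2 / (z - cnj \<rho>) + h z)"
  have log_deriv: "deriv L z / L z = \<phi> z" if z: "z \<in> B" "z \<noteq> \<rho>" "z \<noteq> cnj \<rho>" for z
  proof -
    define a b where "a = z - \<rho>" and "b = z - cnj \<rho>"
    have ab: "a \<noteq> 0" "b \<noteq> 0" using z by (auto simp: a_def b_def)
    have zH: "z \<in> H" using z B by auto
    have quot: "(A' * (C * g) + A * (C' * g + C * g')) / (A * (C * g)) = A' / A + C' / C + g' / g"
      if "A \<noteq> 0" "C \<noteq> 0" "g \<noteq> 0" for A A' C C' g g' :: complex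
      using that by (simp add: divide_simps) (simp add: algebra_simps)
    have "deriv L z = deriv (\<lambda>z. (z - \<rho>) ^ m1 * ((z - cnj \<rho>) ^ m2 * g2 z)) z"
    proof (rule deriv_cong_ev)
      show "\<forall>\<^sub>F w in nhds z. L w = (w - \<rho>) ^ m1 * ((w - cnj \<rho>) ^ m2 * g2 w)"
        using eventually_nhds_in_open[OF H(1) zH] by (rule eventually_mono) (rule L_eq)
    qed simp
    also have "\<dots> = of_nat m1 * a ^ (m1 - 1) * (b ^ m2 * g2 z)
        + a ^ m1 * (of_nat m2 * b ^ (m2 - 1) * g2 z + b ^ m2 * deriv g2 z)"
      using holomorphic_derivI[OF g2(1) H(1) zH]
      by (intro DERIV_imp_deriv) (auto intro!: derivative_eq_intros simp: a_def b_def)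
    also have "\<dots> / L z = of_nat m1 * a ^ (m1 - 1) / a ^ m1 + of_nat m2 * b ^ (m2 - 1) / b ^ m2 + h z"
      unfolding L_eq[OF zH] a_def[symmetric] b_def[symmetric] h_def
      by (rule quot) (use ab g2_nz[OF z(1)] in auto)
    also have "of_nat m1 * a ^ (m1 - 1) / a ^ m1 = of_nat m1 / a"
      using ab by (cases m1) auto
    also have "of_nat m2 * b ^ (m2 - 1) / b ^ m2 = of_nat m2 / b"
      using ab by (cases m2) auto
    finally show ?thesis by (simp add: \<phi>_def a_def b_def)
  qed
  obtain n s where s: "\<bar>s - s1\<bar> < \<delta>" "Re ((deriv ^^ n) \<phi> (of_real s)) = 0"
    using higher_deriv_conjugate_poles_zero[OF Im_\<rho> \<delta>0 g1(4), of h s1 m2] h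
    unfolding B_def r_def \<phi>_def by blast
  have s_near: "\<bar>s - s0\<bar> < e" using s(1) \<delta>1(1) \<eta>(2) by linarith
  then have s_gt_1: "s > 1" using e(2) by linarith
  \<comment> \<open>Where the principal logarithm of L is holomorphic; at real points of U its real
    part is \<open>log_L\<close>. Positivity of L beyond 1 puts s in U.\<close>
  define U where "U = {z \<in> B - {\<rho>, cnj \<rho>}. L z \<in> - \<real>\<^sub>\<le>\<^sub>0}"
  have LB: "L holomorphic_on B - {\<rho>, cnj \<rho>}" using L B holomorphic_on_subset by blast
  have U: "open U"
  proof -
    have "open ((B - {\<rho>, cnj \<rho>}) \<inter> L -` (- \<real>\<^sub>\<le>\<^sub>0))"
      using holomorphic_on_imp_continuous_on[OF LB] B(1)
      by (intro continuous_open_preimage) (auto intro!: open_Diff)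
    then show ?thesis by (simp add: U_def Int_def vimage_def conj_commute)
  qed
  have LnL: "(\<lambda>z. Ln (L z)) holomorphic_on U"
    by (intro holomorphic_intros holomorphic_on_subset[OF LB]) (auto simp: U_def)
  have real_L: "L (of_real x) = of_real (Re (L (of_real x)))" if "of_real x \<in> H" for x
    using dirichlet_L_of_real(2)[of x] that by (simp add: L_def H_def complex_eq_iff)
  have log_eq: "log_L chi x = Re (Ln (L (of_real x)))" if "of_real x \<in> U" for x
  proof -
    have xH: "of_real x \<in> H" using that B by (auto simp: U_def)
    have "L (of_real x) \<notin> \<real>\<^sub>\<le>\<^sub>0" using that by (simp add: U_def)
    then have "Re (L (of_real x)) > 0" using dirichlet_L_of_real(2)[of x] xH
      by (simp add: complex_nonpos_Reals_iff L_def H_def)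
    then show ?thesis
      using Ln_of_real[of "Re (L (of_real x))"] real_L[OF xH] by (simp add: log_L_def L_def)
  qed
  have "norm (of_real s1 - of_real s :: complex) < \<delta>"
    using s(1) by (simp add: norm_minus_commute flip: of_real_diff)
  moreover have "r \<ge> 0" by (simp add: r_def)
  ultimately have "of_real s \<in> B" using \<delta>0 by (simp add: B_def dist_norm)
  moreover have "L (of_real s) \<notin> \<real>\<^sub>\<le>\<^sub>0"
    using Re_dirichlet_L_pos[OF s_gt_1] by (auto simp: complex_nonpos_Reals_iff L_def)
  moreover have "of_real s \<noteq> \<rho>" "of_real s \<noteq> cnj \<rho>" using Im_\<rho> by (auto simp: complex_eq_iff)
  ultimately have sU: "of_real s \<in> U" by (simp add: U_def)
  have "(deriv ^^ Suc n) (log_L chi) s = Re ((deriv ^^ Suc n) (\<lambda>z. Ln (L z)) (of_real s))"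
    by (rule higher_deriv_Re_of_real[OF LnL U log_eq sU])
  also have "(deriv ^^ Suc n) (\<lambda>z. Ln (L z)) (of_real s) = (deriv ^^ n) (deriv (\<lambda>z. Ln (L z))) (of_real s)"
    by (simp only: funpow_Suc_right o_apply)
  \<comment> \<open>One differentiation turns Ln L into \<phi>, hence the order \<open>Suc n\<close>
    for \<open>log_L\<close>, which is at least 1.\<close>
  also have "\<dots> = (deriv ^^ n) \<phi> (of_real s)"
  proof (rule higher_deriv_transform_within_open[OF holomorphic_deriv[OF LnL U] _ U sU])
    show "\<phi> holomorphic_on U"
      unfolding \<phi>_def by (intro holomorphic_intros holomorphic_on_subset[OF h]) (auto simp: U_def)
    show "deriv (\<lambda>z. Ln (L z)) z = \<phi> z" if "z \<in> U" for z
    proof -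
      have z: "z \<in> B" "z \<noteq> \<rho>" "z \<noteq> cnj \<rho>" "L z \<notin> \<real>\<^sub>\<le>\<^sub>0" "z \<in> H" using that B by (auto simp: U_def)
      have "((\<lambda>z. Ln (L z)) has_field_derivative (1 / L z * deriv L z)) (at z)"
        using DERIV_chain2[OF has_field_derivative_Ln[OF z(4)] holomorphic_derivI[OF L H(1) z(5)]]
        by (simp add: inverse_eq_divide)
      then show ?thesis using log_deriv[OF z(1-3)] by (simp add: DERIV_imp_deriv)
    qed
  qed
  finally have "(deriv ^^ Suc n) (log_L chi) s = 0" using s(2) by simp
  then show ?thesis using that s_near by blast
qed

end

section \<open>Choice of the half-line and density\<close>

theorem theorem1:
  fixes q :: nat and chi :: "nat \<Rightarrow> complex"
  assumes "dirichlet_character q chi"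
    and "real_character chi"
    and "chi \<noteq> principal_character q"
    and "primitive_character q chi"
    and "\<forall>s::real. 0 < s \<and> s < 1 \<longrightarrow> dirichlet_L chi (of_real s) \<noteq> 0"
  shows "\<exists>c::real. c \<ge> 1 \<and>
    {c..} \<subseteq> closure ({c..} \<inter> (\<Union>k\<in>{1..}. log_L_deriv_zeros chi k))"
proof -
  interpret real_nonprincipal_character q chi
    using assms by unfold_locales
  have nonreal: "Im s \<noteq> 0" if "Re s > 0" "dirichlet_L chi s = 0" for s
  proof
    assume "Im s = 0"
    then have "of_real (Re s) = s" by (simp add: complex_eq_iff)
    then have "dirichlet_L chi (of_real (Re s)) = 0" using that by simp
    consider "Re s < 1" | "Re s = 1" | "Re s > 1" by linarith
    then show False
    proof cases
      case 1
      then show False using assms(5) that(1) \<open>dirichlet_L chi (of_real (Re s)) = 0\<close> by blast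
    next
      case 2
      then show False using dirichlet_L_1_nonzero \<open>dirichlet_L chi (of_real (Re s)) = 0\<close> by simp
    next
      case 3
      then show False using Re_dirichlet_L_pos[OF 3] \<open>dirichlet_L chi (of_real (Re s)) = 0\<close> by simp
    qed
  qed
  obtain \<rho>0 where \<rho>0: "Re \<rho>0 > 0" "dirichlet_L chi \<rho>0 = 0" by (rule dirichlet_L_has_zero)
  \<comment> \<open>Squaring |s0 - \<rho>0| < s0 turns it into |\<rho>0|^2 < 2 s0 Re \<rho>0, which
    gives the threshold; the maximum ensures c >= 1.\<close>
  define c where "c = max 1 ((norm \<rho>0)\<^sup>2 / (2 * Re \<rho>0))"
  have near: "norm (of_real s0 - \<rho>0) < s0" if "s0 > c" for s0
  proof (rule power2_less_imp_less)
    have "(norm \<rho>0)\<^sup>2 < s0 * (2 * Re \<rho>0)"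
      using that \<rho>0(1) by (simp add: c_def pos_divide_less_eq)
    then show "(norm (of_real s0 - \<rho>0))\<^sup>2 < s0\<^sup>2"
      unfolding cmod_power2 by (simp add: power2_eq_square algebra_simps)
    show "0 \<le> s0" using that by (simp add: c_def)
  qed
  have "x \<in> closure ({c..} \<inter> (\<Union>k\<in>{1..}. log_L_deriv_zeros chi k))" if x: "x \<ge> c" for x
    unfolding closure_approachable
  proof (intro allI impI)
    fix e :: real assume e: "e > 0"
    have x1: "x \<ge> 1" using x by (simp add: c_def)
    \<comment> \<open>Centring at x + e/2 with radius e/2 keeps the zero found strictly to the right
      of x, hence above c and 1, even when x = c.\<close>
    have "norm (of_real (x + e / 2) - \<rho>0) < x + e / 2" by (rule near) (use x e in simp)
    moreover have "e / 2 > 0" "e / 2 \<le> x + e / 2 - 1" using e x1 by simp_all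
    ultimately obtain k s where s: "\<bar>s - (x + e / 2)\<bar> < e / 2" "(deriv ^^ Suc k) (log_L chi) s = 0"
      using log_L_deriv_zero_in_interval[OF nonreal \<rho>0] by metis
    then have "s > x" "s < x + e" by linarith+
    then have "s \<in> {c..}" "s \<in> log_L_deriv_zeros chi (Suc k)" "dist s x < e"
      using x x1 s(2) by (auto simp: log_L_deriv_zeros_def dist_real_def)
    then show "\<exists>y\<in>{c..} \<inter> (\<Union>k\<in>{1..}. log_L_deriv_zeros chi k). dist y x < e"
      by (intro bexI[of _ s]) auto
  qed
  then show ?thesis by (intro exI[of _ c]) (auto simp: c_def)
qed

end
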